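(* Let $K$ be a finite extension of $\mathbb{Q}_2$ with ramification index $e$. For the subspaces $V_{-1}\supseteq V_0\supseteq\dots\supseteq V_{e+1}$ of $K^\times/{K^\times}^2$ defined by $$V_{-1}:=K^\times/{K^\times}^2,\qquad V_k:=U_{2k}{K^\times}^2/{K^\times}^2\quad(0\le k\le e),\qquad V_{e+1}:=1,$$ one has $$V_k^{\#}=V_{e-k}$$ for every $-1\le k\le e+1$.
   Context: $\mathfrak{o}$ is the ring of integers of $K$, $\pi$ a prime element, and $e$ is the largest integer with $\pi^e\mid 2$. $U_0:=\mathfrak{o}^\times$ and $U_n:=1+\pi^n\mathfrak{o}$ for $n\ge1$. $(\cdot,\cdot)_K:K^\times\times K^\times\to\{\pm1\}$ is the quadratic Hilbert symbol of $K$: $(a,b)_K=1$ if and only if $ax^2+by^2=1$ has a solution $x,y\in K$. For $-1\le k\le e+1$, $V_k^{\#}$ denotes the subgroup of all $a{K^\times}^2$ in $K^\times/{K^\times}^2$ such that $(a,b)_K=1$ for all $b{K^\times}^2$ in $V_k$. *)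

theory Defs
  imports "HOL-Computational_Algebra.Computational_Algebra"
begin

text \<open>The ring of 2-adic integers is the inverse limit of the rings \<open>\<int>/2\<^sup>n\<int>\<close>; the
  entry at index \<open>n\<close> is the representative in \<open>{0..<2\<^sup>n}\<close> of the residue modulo \<open>2\<^sup>n\<close>.\<close>

typedef two_adic_int = "{x :: nat \<Rightarrow> int. \<forall>n. x (Suc n) mod 2 ^ n = x n}"
  morphisms two_adic_residue Abs_two_adic_int
  by (rule exI[of _ "\<lambda>_. 0"]) simp

setup_lifting type_definition_two_adic_int

lemma mod_pow_Suc_mod: "a mod 2 ^ Suc n mod 2 ^ n = a mod (2 ^ n :: int)"
  by (rule mod_mod_cancel) simp

lemma two_adic_residue_Suc_mod: "two_adic_residue x (Suc n) mod 2 ^ n = two_adic_residue x n"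
  using two_adic_residue[of x] by simp

lemma two_adic_residue_mod: "m \<le> n \<Longrightarrow> two_adic_residue x n mod 2 ^ m = two_adic_residue x m"
proof (induction n rule: dec_induct)
  case base
  show ?case by (metis mod_mod_trivial two_adic_residue_Suc_mod)
next
  case (step n)
  have "two_adic_residue x (Suc n) mod 2 ^ m = two_adic_residue x (Suc n) mod 2 ^ n mod 2 ^ m"
    using step.hyps by (simp add: mod_mod_cancel le_imp_power_dvd)
  with step.IH show ?case by (simp add: two_adic_residue_Suc_mod)
qed

lemma two_adic_residue_mod_self: "two_adic_residue x n mod 2 ^ n = two_adic_residue x n"
  by (simp add: two_adic_residue_mod)

instantiation two_adic_int :: comm_ring_1
begin

lift_definition zero_two_adic_int :: two_adic_int is "\<lambda>_. 0"
  by simp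

lift_definition one_two_adic_int :: two_adic_int is "\<lambda>n. 1 mod 2 ^ n"
  by (simp add: mod_pow_Suc_mod del: power_Suc)

lift_definition plus_two_adic_int :: "two_adic_int \<Rightarrow> two_adic_int \<Rightarrow> two_adic_int"
  is "\<lambda>x y n. (x n + y n) mod 2 ^ n"
  by (metis mod_add_eq mod_pow_Suc_mod)

lift_definition uminus_two_adic_int :: "two_adic_int \<Rightarrow> two_adic_int"
  is "\<lambda>x n. (- x n) mod 2 ^ n"
  by (metis mod_minus_eq mod_pow_Suc_mod)

lift_definition minus_two_adic_int :: "two_adic_int \<Rightarrow> two_adic_int \<Rightarrow> two_adic_int"
  is "\<lambda>x y n. (x n - y n) mod 2 ^ n"
  by (metis mod_diff_eq mod_pow_Suc_mod)

lift_definition times_two_adic_int :: "two_adic_int \<Rightarrow> two_adic_int \<Rightarrow> two_adic_int"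
  is "\<lambda>x y n. (x n * y n) mod 2 ^ n"
  by (metis mod_mult_eq mod_pow_Suc_mod)

instance
proof
  fix a b c :: two_adic_int
  show "a * b * c = a * (b * c)"
    by transfer (simp add: mod_simps ac_simps)
  show "a * b = b * a"
    by transfer (simp add: mult.commute)
  show "1 * a = a"
    using two_adic_residue_mod_self[of a 0]
    by (simp add: two_adic_residue_inject[symmetric] times_two_adic_int.rep_eq
        one_two_adic_int.rep_eq fun_eq_iff mod_simps two_adic_residue_mod_self)
  show "a + b + c = a + (b + c)"
    by transfer (simp add: mod_simps ac_simps)
  show "a + b = b + a"
    by transfer (simp add: add.commute)
  show "0 + a = a"
    by (simp add: two_adic_residue_inject[symmetric] plus_two_adic_int.rep_eq
        zero_two_adic_int.rep_eq fun_eq_iff two_adic_residue_mod_self)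
  show "- a + a = 0"
    by transfer (simp add: mod_simps)
  show "a - b = a + - b"
    by transfer (simp add: mod_simps)
  show "(a + b) * c = a * c + b * c"
    by transfer (simp add: mod_simps algebra_simps)
  show "(0 :: two_adic_int) \<noteq> 1"
    by transfer (auto simp: fun_eq_iff intro!: exI[of _ 1])
qed

end

instance two_adic_int :: idom
proof
  fix a b :: two_adic_int
  assume "a \<noteq> 0" "b \<noteq> 0"
  then obtain m n where "two_adic_residue a m \<noteq> 0" "two_adic_residue b n \<noteq> 0"
    by (auto simp: two_adic_residue_inject[symmetric] zero_two_adic_int.rep_eq fun_eq_iff)
  hence "\<not> 2 ^ m dvd two_adic_residue a (m + n)" "\<not> 2 ^ n dvd two_adic_residue b (m + n)"
    by (simp_all add: dvd_eq_mod_eq_0 two_adic_residue_mod)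
  hence *: "two_adic_residue a (m + n) \<noteq> 0" "two_adic_residue b (m + n) \<noteq> 0"
    "multiplicity 2 (two_adic_residue a (m + n)) < m" "multiplicity 2 (two_adic_residue b (m + n)) < n"
    by (auto simp: not_le[symmetric] dest: multiplicity_dvd')
  hence "multiplicity 2 (two_adic_residue a (m + n) * two_adic_residue b (m + n)) < m + n"
    by (subst prime_elem_multiplicity_mult_distrib) auto
  hence "\<not> 2 ^ (m + n) dvd two_adic_residue a (m + n) * two_adic_residue b (m + n)"
    using * by (simp add: power_dvd_iff_le_multiplicity)
  thus "a * b \<noteq> 0"
    by (auto simp: two_adic_residue_inject[symmetric] zero_two_adic_int.rep_eq times_two_adic_int.rep_eq
        fun_eq_iff dvd_eq_mod_eq_0)
qed

type_synonym two_adic = "two_adic_int fract"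

definition finite_extension :: "('f :: field \<Rightarrow> 'k :: field) \<Rightarrow> bool" where
  "finite_extension \<iota> \<longleftrightarrow>
     \<iota> 1 = 1 \<and> (\<forall>x y. \<iota> (x + y) = \<iota> x + \<iota> y) \<and> (\<forall>x y. \<iota> (x * y) = \<iota> x * \<iota> y) \<and>
     (\<exists>B. finite B \<and> module.span (\<lambda>c x. \<iota> c * x) B = UNIV)"

text \<open>The ring of integers is the integral closure of the 2-adic integers.\<close>

definition integers :: "(two_adic \<Rightarrow> 'k :: field) \<Rightarrow> 'k set" where
  "integers \<iota> = {x. \<exists>p :: two_adic_int poly. lead_coeff p = 1 \<and>
                      poly (map_poly (\<lambda>c. \<iota> (Fract c 1)) p) x = 0}"

text \<open>Divisibility, units and prime elements of a subring \<open>R\<close>; these differ from the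
  type-class notions, which refer to the whole field.\<close>

definition divides_in :: "'k :: field set \<Rightarrow> 'k \<Rightarrow> 'k \<Rightarrow> bool" where
  "divides_in R a b \<longleftrightarrow> (\<exists>c\<in>R. b = a * c)"

definition units_in :: "'k :: field set \<Rightarrow> 'k set" where
  "units_in R = {a \<in> R. divides_in R a 1}"

definition prime_in :: "'k :: field set \<Rightarrow> 'k \<Rightarrow> bool" where
  "prime_in R p \<longleftrightarrow> p \<in> R \<and> p \<noteq> 0 \<and> p \<notin> units_in R \<and>
     (\<forall>a\<in>R. \<forall>b\<in>R. divides_in R p (a * b) \<longrightarrow> divides_in R p a \<or> divides_in R p b)"

definition ramification_index :: "(two_adic \<Rightarrow> 'k :: field) \<Rightarrow> 'k \<Rightarrow> nat" where
  "ramification_index \<iota> \<pi> = (GREATEST n. divides_in (integers \<iota>) (\<pi> ^ n) 2)"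

definition unit_filtration :: "(two_adic \<Rightarrow> 'k :: field) \<Rightarrow> 'k \<Rightarrow> nat \<Rightarrow> 'k set" where
  "unit_filtration \<iota> \<pi> n =
     (if n = 0 then units_in (integers \<iota>) else {1 + \<pi> ^ n * x | x. x \<in> integers \<iota>})"

definition hilbert_symbol :: "'k :: field \<Rightarrow> 'k \<Rightarrow> int" where
  "hilbert_symbol a b = (if \<exists>x y. a * x\<^sup>2 + b * y\<^sup>2 = 1 then 1 else - 1)"

text \<open>Elements of the quotient of the multiplicative group by its subgroup of squares are
  represented as cosets.\<close>

definition square_class :: "'k :: field \<Rightarrow> 'k set" where
  "square_class a = {a * s\<^sup>2 | s. s \<noteq> 0}"

definition square_classes :: "'k :: field set set" where
  "square_classes = square_class ` {a. a \<noteq> 0}"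

text \<open>For every \<open>k > e\<close> the value is the trivial subgroup, and for every \<open>k < 0\<close> the whole
  group; only the indices from \<open>- 1\<close> to \<open>e + 1\<close> matter.\<close>

definition V_filtration :: "(two_adic \<Rightarrow> 'k :: field) \<Rightarrow> 'k \<Rightarrow> int \<Rightarrow> 'k set set" where
  "V_filtration \<iota> \<pi> k =
     (if k < 0 then square_classes
      else if k \<le> int (ramification_index \<iota> \<pi>)
        then square_class ` {u * s\<^sup>2 | u s. u \<in> unit_filtration \<iota> \<pi> (nat (2 * k)) \<and> s \<noteq> 0}
      else {square_class 1})"

definition hilbert_orthogonal :: "'k :: field set set \<Rightarrow> 'k set set" where
  "hilbert_orthogonal W =
     {square_class a | a. a \<noteq> 0 \<and>
        (\<forall>b. b \<noteq> 0 \<and> square_class b \<in> W \<longrightarrow> hilbert_symbol a b = 1)}"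

end

theory Submission
  imports Defs "Jordan_Normal_Form.Char_Poly"
begin

text \<open>
  If \<open>L\<close> is a subring of \<open>K\<close> that spans \<open>K\<close> and is finitely generated over the 2-adic integers,
  compactness gives an \<open>M\<close> such that every \<open>y \<in> L - 2L\<close> divides \<open>2\<^sup>M\<close> in \<open>L\<close>. So powers of \<open>x\<close> that leave
  \<open>2\<^sup>-\<^sup>M L\<close> have an inverse in \<open>L\<close>, and the power-bounded elements, which are the integral ones, form
  a complete valuation ring with finite residue field.

  Write \<open>a = 1 + \<pi>\<^sup>2\<^sup>k \<alpha>\<close>, \<open>b = 1 + \<pi>\<^sup>2\<^sup>k\<^sup>' \<beta>\<close>, \<open>2 = \<pi>\<^sup>e \<epsilon>\<close>. The substitution
  \<open>x = \<pi>\<^sup>k\<^sup>' r\<close>, \<open>y = \<pi>\<^sup>k t\<close>, \<open>z = x + y + \<pi>\<^sup>k\<^sup>+\<^sup>k\<^sup>' s\<close> turns \<open>a x\<^sup>2 + b y\<^sup>2 - z\<^sup>2\<close> into a multiple of an explicit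
  ternary form in \<open>r, t, s\<close>. If \<open>k + k' = e\<close>, its reduction modulo \<open>\<pi>\<close> has a smooth zero, which lifts
  by Hensel's lemma, so \<open>(a, b) = 1\<close>. Conversely, modulo squares every element outside level \<open>e - k\<close>
  is a prime element or \<open>1 + \<pi>\<^sup>2\<^sup>i\<^sup>+\<^sup>1 u\<close> with \<open>u\<close> a unit and \<open>i < e - k\<close>. It is detected by \<open>1 + 4\<rho>\<close>,
  respectively by \<open>1 + \<pi>\<^sup>2\<^sup>i\<^sup>'\<^sup>+\<^sup>1 w\<close> with \<open>i + i' = e - 1\<close>, because the form then reduces to the
  anisotropic norm form given by a residue \<open>\<rho>\<close> that is not of the form \<open>y\<^sup>2 + y\<close>.
\<close>

section \<open>The 2-adic integers\<close>

lemma two_adic_eqI: "(\<And>n. two_adic_residue x n = two_adic_residue y n) \<Longrightarrow> x = y"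
  by (simp add: two_adic_residue_inject[symmetric] fun_eq_iff)

lemma two_adic_residue_power_two: "two_adic_residue (2 ^ n) k = 2 ^ n mod 2 ^ k"
proof (induction n)
  case 0
  show ?case by (simp add: one_two_adic_int.rep_eq)
next
  case (Suc n)
  have "(2 :: two_adic_int) ^ Suc n = 2 ^ n + 2 ^ n" by simp
  hence "two_adic_residue (2 ^ Suc n) k = (2 ^ n mod 2 ^ k + 2 ^ n mod 2 ^ k) mod 2 ^ k"
    by (metis Suc plus_two_adic_int.rep_eq)
  also have "\<dots> = (2 ^ n + 2 ^ n) mod 2 ^ k" by (simp add: mod_simps)
  finally show ?case by simp
qed

lemma two_adic_power_two_dvd_iff: "2 ^ n dvd x \<longleftrightarrow> two_adic_residue x n = 0"
proof
  assume "2 ^ n dvd x"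
  then obtain y where "x = 2 ^ n * y" by blast
  thus "two_adic_residue x n = 0"
    by (simp add: times_two_adic_int.rep_eq two_adic_residue_power_two)
next
  assume x: "two_adic_residue x n = 0"
  \<comment> \<open>\<open>f k\<close> is the residue of x / 2^n modulo 2^k. Division drops the n
    lowest binary digits, so x has to be read n digits further.\<close>
  define f where "f k = two_adic_residue x (n + k) div 2 ^ n" for k
  have f: "f (Suc k) mod 2 ^ k = f k" for k
  proof -
    have "two_adic_residue x (n + k) = two_adic_residue x (n + Suc k) mod (2 ^ n * 2 ^ k)"
      by (simp add: two_adic_residue_mod flip: power_add)
    also have "\<dots> = 2 ^ n * (f (Suc k) mod 2 ^ k) + two_adic_residue x (n + Suc k) mod 2 ^ n"
      unfolding f_def by (subst zmod_zmult2_eq) simp_all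
    also have "two_adic_residue x (n + Suc k) mod 2 ^ n = 0"
      using x by (simp add: two_adic_residue_mod)
    finally show ?thesis by (simp add: f_def)
  qed
  define y where "y = Abs_two_adic_int f"
  have y: "two_adic_residue y = f"
    unfolding y_def by (rule Abs_two_adic_int_inverse) (simp add: f)
  have "x = 2 ^ n * y"
  proof (rule two_adic_eqI)
    fix k
    have "two_adic_residue x (n + k) mod 2 ^ n = 0"
      using x by (simp add: two_adic_residue_mod)
    hence "2 ^ n * f k = two_adic_residue x (n + k)"
      by (auto simp: f_def)
    moreover have "two_adic_residue (2 ^ n * y) k = (2 ^ n * f k) mod 2 ^ k"
      by (simp add: times_two_adic_int.rep_eq two_adic_residue_power_two y mod_simps)
    ultimately show "two_adic_residue x k = two_adic_residue (2 ^ n * y) k"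
      by (simp add: two_adic_residue_mod)
  qed
  thus "2 ^ n dvd x" by simp
qed

lemma two_adic_separated:
  assumes "\<And>n. 2 ^ n dvd (x :: two_adic_int)"
  shows "x = 0"
  using assms by (intro two_adic_eqI) (simp add: two_adic_power_two_dvd_iff zero_two_adic_int.rep_eq)

text \<open>Convergence of 2-adic series: later terms do not change the n-th partial sum modulo 2^n,
  so the residues of the partial sums S n modulo 2^n form a compatible sequence.\<close>

lemma two_adic_complete:
  fixes f :: "nat \<Rightarrow> two_adic_int"
  obtains s where "\<And>n. 2 ^ n dvd s - (\<Sum>i<n. 2 ^ i * f i)"
proof -
  define S where "S n = (\<Sum>i<n. 2 ^ i * f i)" for n
  define g where "g n = two_adic_residue (S n) n" for n
  have g: "g (Suc n) mod 2 ^ n = g n" for n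
  proof -
    have "g (Suc n) mod 2 ^ n = two_adic_residue (S (Suc n)) n"
      by (simp add: g_def two_adic_residue_Suc_mod)
    also have "S (Suc n) = S n + 2 ^ n * f n" by (simp add: S_def)
    also have "two_adic_residue \<dots> n = g n"
      by (simp add: plus_two_adic_int.rep_eq times_two_adic_int.rep_eq two_adic_residue_power_two
          g_def two_adic_residue_mod_self)
    finally show ?thesis .
  qed
  define s where "s = Abs_two_adic_int g"
  have s: "two_adic_residue s = g"
    unfolding s_def by (rule Abs_two_adic_int_inverse) (simp add: g)
  have "2 ^ n dvd s - S n" for n
    by (simp add: two_adic_power_two_dvd_iff minus_two_adic_int.rep_eq s g_def)
  thus thesis using that unfolding S_def by blast
qed

lemma two_adic_even_or_odd: "2 dvd (x :: two_adic_int) \<or> 2 dvd x - 1"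
proof -
  have "two_adic_residue x 1 \<in> {0..<2}"
    using two_adic_residue_mod_self[of x 1] by (metis atLeastLessThan_iff pos_mod_bound
        pos_mod_sign power_one_right zero_less_numeral)
  hence "two_adic_residue x 1 = 0 \<or> two_adic_residue x 1 = 1" by auto
  thus ?thesis
    using two_adic_power_two_dvd_iff[of 1 x] two_adic_power_two_dvd_iff[of 1 "x - 1"]
    by (auto simp: minus_two_adic_int.rep_eq one_two_adic_int.rep_eq)
qed

lemma two_adic_odd_not_even: "2 dvd x - 1 \<Longrightarrow> \<not> 2 dvd (x :: two_adic_int)"
  using two_adic_power_two_dvd_iff[of 1 x] two_adic_power_two_dvd_iff[of 1 "x - 1"]
  by (auto simp: minus_two_adic_int.rep_eq one_two_adic_int.rep_eq)

text \<open>Geometric series: if x = 1 + 2b, the inverse is the sum of all 2^i (-b)^i.\<close>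

lemma two_adic_odd_unit:
  assumes "2 dvd (x :: two_adic_int) - 1"
  shows "x dvd 1"
proof -
  obtain b where b: "x - 1 = 2 * b" using assms by blast
  obtain s where s: "\<And>n. 2 ^ n dvd s - (\<Sum>i<n. 2 ^ i * (- b) ^ i)"
    using two_adic_complete[of "\<lambda>i. (- b) ^ i"] by blast
  have "2 ^ n dvd x * s - 1" for n
  proof -
    have *: "(\<Sum>i<n. 2 ^ i * (- b) ^ i) = (\<Sum>i<n. (1 - x) ^ i)"
      using b by (simp flip: power_mult_distrib) (metis minus_diff_eq)
    have "x * (\<Sum>i<n. (1 - x) ^ i) = 1 - (1 - x) ^ n"
      by (simp add: one_diff_power_eq)
    hence "x * s - 1 = x * (s - (\<Sum>i<n. 2 ^ i * (- b) ^ i)) - (1 - x) ^ n"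
      unfolding * by (simp add: algebra_simps)
    moreover have "1 - x = 2 * (- b)" using b by (simp add: algebra_simps)
    hence "2 ^ n dvd (1 - x) ^ n" by (simp add: power_mult_distrib del: mult_minus_right)
    ultimately show ?thesis using s[of n] by (simp add: dvd_diff)
  qed
  hence "x * s - 1 = 0" by (rule two_adic_separated)
  thus ?thesis by (metis dvd_triv_left eq_iff_diff_eq_0)
qed

text \<open>Some 2^n does not divide x, so after fewer than n divisions by 2 an odd element, hence a
  unit, remains. This is what allows denominators of 2-adic numbers to be cleared by powers of
  2.\<close>

lemma two_adic_dvd_power_two:
  assumes "x \<noteq> (0 :: two_adic_int)"
  shows "\<exists>n. x dvd 2 ^ n"
proof -
  have *: "\<exists>m. x dvd 2 ^ m" if "\<not> 2 ^ n dvd x" for n and x :: two_adic_int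
    using that
  proof (induction n arbitrary: x)
    case (Suc n)
    show ?case
    proof (cases "2 dvd x")
      case True
      then obtain y where y: "x = 2 * y" by blast
      with Suc.prems have "\<not> 2 ^ n dvd y" by auto
      then obtain m where "y dvd 2 ^ m" using Suc.IH by blast
      hence "x dvd 2 ^ Suc m" by (simp add: y mult_dvd_mono)
      thus ?thesis by blast
    next
      case False
      hence "x dvd 1" using two_adic_even_or_odd two_adic_odd_unit by blast
      thus ?thesis by (intro exI[of _ 0]) simp
    qed
  qed simp
  show ?thesis using assms * two_adic_separated by blast
qed

section \<open>Lattices in a finite extension\<close>

locale two_adic_extension =
  fixes \<iota> :: "two_adic \<Rightarrow> 'k :: field"
  assumes ext: "finite_extension \<iota>"
begin

lemma embedding: "\<iota> 1 = 1" "\<iota> (x + y) = \<iota> x + \<iota> y" "\<iota> (x * y) = \<iota> x * \<iota> y"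
  using ext by (auto simp: finite_extension_def)

lemma embedding_zero: "\<iota> 0 = 0"
  by (metis add.right_neutral add_left_cancel embedding(2))

lemma embedding_nonzero: "x \<noteq> 0 \<Longrightarrow> \<iota> x \<noteq> 0"
  using embedding(1) embedding(3)[of x "inverse x"] by auto

definition j :: "two_adic_int \<Rightarrow> 'k" where "j c = \<iota> (Fract c 1)"

lemma j_add: "j (x + y) = j x + j y"
  by (simp add: j_def flip: embedding(2))

lemma j_mult: "j (x * y) = j x * j y"
  by (simp add: j_def flip: embedding(3))

lemma j_one: "j 1 = 1"
  by (simp add: j_def embedding(1) flip: One_fract_def)

lemma j_zero: "j 0 = 0"
  by (simp add: j_def embedding_zero flip: Zero_fract_def)

sublocale j: comm_ring_hom j
  by standard (simp_all add: j_add j_mult j_one j_zero)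

lemma j_nonzero: "x \<noteq> 0 \<Longrightarrow> j x \<noteq> 0"
  unfolding j_def by (rule embedding_nonzero) (simp add: eq_fract Zero_fract_def)

lemma j_two: "j 2 = 2"
  by (metis j_add j_one one_add_one)

lemma two_power: "(2 :: 'k) ^ n = j (2 ^ n)"
  by (simp add: j.hom_power j_two)

lemma two_nonzero: "(2 :: 'k) \<noteq> 0"
proof -
  have "(2 :: two_adic_int) \<noteq> 0"
    using two_adic_residue_power_two[of 1 2] by (auto simp: zero_two_adic_int.rep_eq)
  thus ?thesis using two_power[of 1] j_nonzero[of 2] by simp
qed

sublocale K: Modules.module "\<lambda>c x. \<iota> c * x"
  by standard (simp_all add: embedding algebra_simps)

text \<open>The field as a module over the 2-adic integers; its finitely generated submodules
  \<open>Z.span G\<close> are the lattices below.\<close>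

sublocale Z: Modules.module "\<lambda>c x. j c * x"
  by standard (simp_all add: j_add j_mult j_one algebra_simps)

text \<open>The determinant trick. The generators form an eigenvector, with eigenvalue x, of a
  matrix over the 2-adic integers; it is nonzero because 1 is among them. So x is a root of the
  monic characteristic polynomial.\<close>

lemma integersI:
  assumes G: "finite G" "1 \<in> G" and closed: "\<And>g. g \<in> G \<Longrightarrow> x * g \<in> Z.span G"
  shows "x \<in> integers \<iota>"
proof -
  obtain gs where gs: "set gs = G" "distinct gs" using finite_distinct_list G by blast
  define n where "n = length gs"
  have "\<forall>g\<in>G. \<exists>u. x * g = (\<Sum>h\<in>G. j (u h) * h)"
    using closed G by (auto simp: Z.span_finite)
  then obtain u where u: "\<And>g. g \<in> G \<Longrightarrow> x * g = (\<Sum>h\<in>G. j (u g h) * h)"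
    by metis
  define A where "A = mat n n (\<lambda>(i, l). u (gs ! i) (gs ! l))"
  have A: "A \<in> carrier_mat n n" by (simp add: A_def)
  define v where "v = vec n (\<lambda>i. gs ! i)"
  have "eigenvector (map_mat j A) v x"
    unfolding eigenvector_def
  proof (intro conjI)
    show "v \<in> carrier_vec (dim_row (map_mat j A))" by (simp add: v_def A_def)
    obtain i where "i < n" "gs ! i = 1" using G gs unfolding n_def by (metis in_set_conv_nth)
    thus "v \<noteq> 0\<^sub>v (dim_row (map_mat j A))"
      by (auto simp: v_def A_def vec_eq_iff intro!: exI[of _ i])
    show "map_mat j A *\<^sub>v v = x \<cdot>\<^sub>v v"
    proof (rule eq_vecI)
      fix i assume "i < dim_vec (x \<cdot>\<^sub>v v)"
      hence i: "i < n" by (simp add: v_def)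
      hence iG: "gs ! i \<in> G" using gs by (auto simp: n_def)
      have "(map_mat j A *\<^sub>v v) $ i = (\<Sum>l<n. j (u (gs ! i) (gs ! l)) * gs ! l)"
        using i by (simp add: A_def v_def scalar_prod_def atLeast0LessThan)
      also have "\<dots> = (\<Sum>h\<in>G. j (u (gs ! i) h) * h)"
        by (rule sum.reindex_bij_betw) (use gs in \<open>auto simp: n_def intro!: bij_betw_nth\<close>)
      also have "\<dots> = (x \<cdot>\<^sub>v v) $ i" using u[OF iG] i by (simp add: v_def)
      finally show "(map_mat j A *\<^sub>v v) $ i = (x \<cdot>\<^sub>v v) $ i" .
    qed (simp add: A_def v_def)
  qed
  hence "eigenvalue (map_mat j A) x" by (auto simp: eigenvalue_def)
  hence "poly (char_poly (map_mat j A)) x = 0"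
    by (subst (asm) eigenvalue_root_char_poly[of _ n]) (use A in simp_all)
  hence "poly (map_poly j (char_poly A)) x = 0"
    using j.char_poly_hom[OF A] by simp
  moreover have "lead_coeff (char_poly A) = 1"
    using degree_monic_char_poly[OF A] by simp
  ultimately show ?thesis by (auto simp: integers_def j_def[abs_def])
qed

text \<open>Every coefficient is 0 or 1 modulo 2, so the subset sums of G represent all
  classes.\<close>

lemma span_finite_mod_two:
  assumes "finite G"
  shows "\<exists>F. finite F \<and> (\<forall>x\<in>Z.span G. \<exists>r\<in>F. \<exists>y\<in>Z.span G. x - r = 2 * y)"
proof -
  define F where "F = Z.span G \<inter> (\<lambda>H. \<Sum>g\<in>H. g) ` Pow G"
  have "\<exists>r\<in>F. \<exists>y\<in>Z.span G. x - r = 2 * y" if x: "x \<in> Z.span G" for x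
  proof -
    obtain u where u: "x = (\<Sum>g\<in>G. j (u g) * g)"
      using x assms by (auto simp: Z.span_finite)
    define H where "H = {g \<in> G. \<not> 2 dvd u g}"
    have "\<exists>w. u g = (if g \<in> H then 1 else 0) + 2 * w" if "g \<in> G" for g
    proof (cases "2 dvd u g")
      case True
      thus ?thesis using that by (auto simp: H_def)
    next
      case False
      then obtain w where "u g - 1 = 2 * w" using two_adic_even_or_odd by blast
      thus ?thesis using that False by (auto simp: H_def algebra_simps intro!: exI[of _ w])
    qed
    then obtain w where w: "\<And>g. g \<in> G \<Longrightarrow> u g = (if g \<in> H then 1 else 0) + 2 * w g"
      by metis
    have "x = (\<Sum>g\<in>G. (if g \<in> H then g else 0) + 2 * (j (w g) * g))"
      unfolding u by (rule sum.cong) (simp_all add: w j_add j_mult j_one j_zero j_two algebra_simps)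
    also have "\<dots> = (\<Sum>g\<in>G. if g \<in> H then g else 0) + 2 * (\<Sum>g\<in>G. j (w g) * g)"
      by (simp add: sum.distrib sum_distrib_left)
    also have "(\<Sum>g\<in>G. if g \<in> H then g else 0) = (\<Sum>g\<in>H. g)"
      using assms by (simp add: H_def sum.inter_filter)
    finally have "x - (\<Sum>g\<in>H. g) = 2 * (\<Sum>g\<in>G. j (w g) * g)" by simp
    moreover have "(\<Sum>g\<in>H. g) \<in> F"
      unfolding F_def by (intro IntI imageI Z.span_sum Z.span_base) (auto simp: H_def)
    moreover have "(\<Sum>g\<in>G. j (w g) * g) \<in> Z.span G"
      by (intro Z.span_sum Z.span_scale Z.span_base)
    ultimately show ?thesis by blast
  qed
  moreover have "finite F" using assms by (simp add: F_def)
  ultimately show ?thesis by blast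
qed

text \<open>The series is summed coefficient by coefficient, after choosing coefficients of every
  term with respect to G.\<close>

lemma span_complete:
  assumes "finite G" and f: "\<And>n. f n \<in> Z.span G"
  shows "\<exists>s\<in>Z.span G. \<forall>n. \<exists>t\<in>Z.span G. s - (\<Sum>i<n. 2 ^ i * f i) = 2 ^ n * t"
proof -
  have "\<forall>n. \<exists>u. f n = (\<Sum>g\<in>G. j (u g) * g)"
    using f assms(1) by (auto simp: Z.span_finite)
  then obtain u where u: "\<And>n. f n = (\<Sum>g\<in>G. j (u n g) * g)" by metis
  have "\<forall>g. \<exists>s. \<forall>n. \<exists>t. s - (\<Sum>i<n. 2 ^ i * u i g) = 2 ^ n * t"
    using two_adic_complete unfolding dvd_def by meson
  from choice[OF this] obtain s where s: "\<And>g n. \<exists>t. s g - (\<Sum>i<n. 2 ^ i * u i g) = 2 ^ n * t"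
    by blast
  define t where "t g n = (SOME t. s g - (\<Sum>i<n. 2 ^ i * u i g) = 2 ^ n * t)" for g n
  have t: "s g - (\<Sum>i<n. 2 ^ i * u i g) = 2 ^ n * t g n" for g n
    unfolding t_def using s by (rule someI_ex)
  have eq: "(\<Sum>g\<in>G. j (s g) * g) - (\<Sum>i<n. 2 ^ i * f i) = 2 ^ n * (\<Sum>g\<in>G. j (t g n) * g)" for n
  proof -
    have "(\<Sum>i<n. 2 ^ i * f i) = (\<Sum>g\<in>G. \<Sum>i<n. 2 ^ i * (j (u i g) * g))"
      unfolding u sum_distrib_left by (rule sum.swap)
    also have "\<dots> = (\<Sum>g\<in>G. j (\<Sum>i<n. 2 ^ i * u i g) * g)"
      by (simp add: j.hom_sum j_mult j.hom_power j_two sum_distrib_right mult.assoc)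
    finally have "(\<Sum>g\<in>G. j (s g) * g) - (\<Sum>i<n. 2 ^ i * f i) =
        (\<Sum>g\<in>G. (j (s g) - j (\<Sum>i<n. 2 ^ i * u i g)) * g)"
      by (simp add: sum_subtractf left_diff_distrib)
    moreover have "j (s g) - j (\<Sum>i<n. 2 ^ i * u i g) = 2 ^ n * j (t g n)" for g
      unfolding j.hom_minus[symmetric] t by (simp add: j_mult j.hom_power j_two)
    hence "(\<Sum>g\<in>G. (j (s g) - j (\<Sum>i<n. 2 ^ i * u i g)) * g) =
        2 ^ n * (\<Sum>g\<in>G. j (t g n) * g)"
      by (simp only: sum_distrib_left mult.assoc)
    ultimately show ?thesis by simp
  qed
  have span: "(\<Sum>g\<in>G. j (w g) * g) \<in> Z.span G" for w
    by (intro Z.span_sum Z.span_scale Z.span_base)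
  show ?thesis
    by (rule bexI[OF _ span[of s]]) (rule allI, rule bexI, rule eq, rule span)
qed

lemma span_two_power: "x \<in> Z.span G \<Longrightarrow> 2 ^ n * x \<in> Z.span G"
  unfolding two_power by (rule Z.span_scale)

lemma span_two_power_mono: "2 ^ m * x \<in> Z.span G \<Longrightarrow> m \<le> n \<Longrightarrow> 2 ^ n * x \<in> Z.span G"
  using span_two_power[of "2 ^ m * x" G "n - m"] 
  by (simp add: mult.assoc[symmetric] power_add[symmetric])

lemma span_archimedean:
  assumes B: "K.span B = UNIV" and G: "\<And>b. b \<in> B \<Longrightarrow> \<exists>m. 2 ^ m * b \<in> Z.span G"
  shows "\<exists>m. 2 ^ m * x \<in> Z.span G"
proof -
  have "K.span B \<subseteq> {x. \<exists>m. 2 ^ m * x \<in> Z.span G}"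
  proof (rule K.span_minimal)
    show "K.subspace {x. \<exists>m. 2 ^ m * x \<in> Z.span G}"
    proof (rule K.subspaceI; clarsimp)
      show "0 \<in> Z.span G" by (rule Z.span_zero)
    next
      fix x y m n assume "2 ^ m * x \<in> Z.span G" "2 ^ n * y \<in> Z.span G"
      hence "2 ^ max m n * x \<in> Z.span G" "2 ^ max m n * y \<in> Z.span G"
        using span_two_power_mono by (metis max.cobounded1, metis max.cobounded2)
      hence "2 ^ max m n * (x + y) \<in> Z.span G" by (simp add: Z.span_add distrib_left)
      thus "\<exists>m. 2 ^ m * (x + y) \<in> Z.span G" by blast
    next
      fix c :: two_adic and x m assume x: "2 ^ m * x \<in> Z.span G"
      obtain a d where c: "c = Fract a d" and d0: "d \<noteq> 0" by (cases c)
      \<comment> \<open>The denominator of c divides a power of 2, so scaling by c costs only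
        finitely many factors 2.\<close>
      obtain n d' where d: "2 ^ n = d * d'" using two_adic_dvd_power_two[OF d0] by (auto simp: dvd_def)
      have "Fract (2 ^ n) 1 * c = Fract (a * d') 1"
        unfolding d c using d0 by (simp add: eq_fract algebra_simps)
      hence "2 ^ n * \<iota> c = j (a * d')"
        by (simp add: two_power j_def flip: embedding(3))
      hence "2 ^ (n + m) * (\<iota> c * x) = j (a * d') * (2 ^ m * x)"
        by (simp add: power_add algebra_simps)
      also have "\<dots> \<in> Z.span G" using x by (rule Z.span_scale)
      finally show "\<exists>m. 2 ^ m * (\<iota> c * x) \<in> Z.span G" by blast
    qed
  qed (use G in auto)
  thus ?thesis using B by blast
qed

text \<open>Let 2^N clear the denominators of all products of two elements of B. Then a product of
  two elements of 2^N B lies in 2^N times the span of B, hence in the lattice generated by 2^N B;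
  adjoining 1 yields a ring with unit.\<close>

lemma lattice_order_exists:
  obtains G where "finite G" "1 \<in> G" "\<And>x. \<exists>m. 2 ^ m * x \<in> Z.span G"
    "\<And>x y. x \<in> Z.span G \<Longrightarrow> y \<in> Z.span G \<Longrightarrow> x * y \<in> Z.span G"
proof -
  obtain B where B: "finite B" "K.span B = UNIV" using ext by (auto simp: finite_extension_def)
  have *: "\<exists>m. 2 ^ m * x \<in> Z.span B" for x
    by (rule span_archimedean[OF B(2)]) (auto intro!: exI[of _ 0] Z.span_base)
  then obtain m where m: "\<And>x. 2 ^ m x * x \<in> Z.span B" by metis
  define N where "N = Max (insert 0 ((\<lambda>(b, c). m (b * c)) ` (B \<times> B)))"
  have N: "2 ^ N * (b * c) \<in> Z.span B" if "b \<in> B" "c \<in> B" for b c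
  proof (rule span_two_power_mono[OF m])
    show "m (b * c) \<le> N" unfolding N_def
      by (rule Max_ge) (use that B in \<open>auto intro!: image_eqI[of _ _ "(b, c)"]\<close>)
  qed
  define G where "G = insert 1 ((*) (2 ^ N) ` B)"
  have BG: "2 ^ N * x \<in> Z.span G" if "x \<in> Z.span B" for x
  proof -
    have "Z.span B \<subseteq> {x. 2 ^ N * x \<in> Z.span G}"
    proof (rule Z.span_minimal)
      show "Z.subspace {x. 2 ^ N * x \<in> Z.span G}"
      proof (rule Z.subspaceI; clarsimp)
        show "0 \<in> Z.span G" by (rule Z.span_zero)
      next
        fix x y assume "2 ^ N * x \<in> Z.span G" "2 ^ N * y \<in> Z.span G"
        thus "2 ^ N * (x + y) \<in> Z.span G" by (simp add: Z.span_add distrib_left)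
      next
        fix c x assume "2 ^ N * x \<in> Z.span G"
        hence "j c * (2 ^ N * x) \<in> Z.span G" by (rule Z.span_scale)
        thus "2 ^ N * (j c * x) \<in> Z.span G" by (simp add: mult_ac)
      qed
    qed (auto simp: G_def intro!: Z.span_base)
    thus ?thesis using that by blast
  qed
  have GG: "g * h \<in> Z.span G" if gh: "g \<in> G" "h \<in> G" for g h
  proof (cases "g = 1 \<or> h = 1")
    case True
    thus ?thesis using gh by (auto intro: Z.span_base)
  next
    case False
    then obtain b c where bc: "b \<in> B" "c \<in> B" "g = 2 ^ N * b" "h = 2 ^ N * c"
      using gh by (auto simp: G_def)
    have "2 ^ N * (2 ^ N * (b * c)) \<in> Z.span G" using BG N bc by blast
    thus ?thesis by (simp add: bc mult_ac)
  qed
  have sub: "Z.subspace {x. x * y \<in> Z.span G}" for y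
  proof (rule Z.subspaceI; clarsimp)
    show "0 \<in> Z.span G" by (rule Z.span_zero)
  next
    fix a b assume "a * y \<in> Z.span G" "b * y \<in> Z.span G"
    thus "(a + b) * y \<in> Z.span G" by (simp add: Z.span_add distrib_right)
  next
    fix c x assume "x * y \<in> Z.span G"
    thus "j c * x * y \<in> Z.span G" using Z.span_scale[of "x * y" G c] by (simp add: mult.assoc)
  qed
  have 1: "x * h \<in> Z.span G" if "x \<in> Z.span G" "h \<in> G" for x h
    using Z.span_minimal[OF _ sub[of h], of G] GG that by blast
  have "x * y \<in> Z.span G" if "x \<in> Z.span G" "y \<in> Z.span G" for x y
    using Z.span_minimal[OF _ sub[of x], of G] 1[OF that(1)] that(2)
    by (metis (no_types, lifting) mem_Collect_eq mult.commute subset_iff)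
  moreover have "\<exists>m. 2 ^ m * x \<in> Z.span G" for x
    by (rule span_archimedean[OF B(2)]) (auto simp: G_def intro!: exI[of _ N] Z.span_base)
  ultimately show thesis using that[of G] B(1) by (auto simp: G_def)
qed

text \<open>Multiplying a monic equation of degree n for 1/2 by 2^n leaves 1 plus an even 2-adic
  integer equal to 0.\<close>

lemma half_notin_integers: "inverse 2 \<notin> integers \<iota>"
proof
  assume "inverse 2 \<in> integers \<iota>"
  then obtain p where p: "lead_coeff p = 1" "poly (map_poly j p) (inverse 2) = 0"
    by (auto simp: integers_def j_def[abs_def])
  define n where "n = degree p"
  have deg: "degree (map_poly j p) = n"
    unfolding n_def by (rule degree_map_poly) (use p in \<open>auto simp: j_one\<close>)
  have "0 = 2 ^ n * (\<Sum>i\<le>n. j (coeff p i) * inverse 2 ^ i)"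
    using p(2) by (simp add: poly_altdef deg coeff_map_poly j_zero)
  also have "\<dots> = (\<Sum>i\<le>n. j (coeff p i * 2 ^ (n - i)))"
    unfolding sum_distrib_left
  proof (rule sum.cong)
    fix i assume "i \<in> {..n}"
    hence "(2 :: 'k) ^ n = 2 ^ (n - i) * 2 ^ i" by (simp flip: power_add)
    moreover have "(2 :: 'k) ^ i * inverse 2 ^ i = 1"
      using two_nonzero by (simp flip: power_mult_distrib)
    ultimately show "2 ^ n * (j (coeff p i) * inverse 2 ^ i) = j (coeff p i * 2 ^ (n - i))"
      by (simp add: j_mult j.hom_power j_two mult.assoc)
  qed simp
  also have "\<dots> = j (\<Sum>i\<le>n. coeff p i * 2 ^ (n - i))" by (simp add: j.hom_sum)
  finally have "(\<Sum>i\<le>n. coeff p i * 2 ^ (n - i)) = 0" using j_nonzero by metis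
  hence "(\<Sum>i<n. coeff p i * 2 ^ (n - i)) + 1 = 0"
    using p(1) by (simp add: lessThan_Suc_atMost[symmetric] n_def)
  moreover have "2 dvd (\<Sum>i<n. coeff p i * 2 ^ (n - i))"
    by (intro dvd_sum dvd_mult) (simp add: dvd_power)
  ultimately have "(2 :: two_adic_int) dvd -1" by (metis add_eq_0_iff2 minus_minus)
  thus False using two_adic_odd_not_even[of "-1"] by simp
qed

end

section \<open>Complete valuation rings of mixed characteristic 2\<close>

text \<open>The properties of the ring of integers on which the symbol computation rests. Finiteness
  and completeness are stated with respect to 2, as they come from a lattice; that powers of \<pi>
  and of 2 bound each other is derived below.\<close>

locale dyadic_valuation_ring =
  fixes R :: "'k :: field set" and \<pi> :: 'k
  assumes one_closed: "1 \<in> R"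
    and add_closed: "x \<in> R \<Longrightarrow> y \<in> R \<Longrightarrow> x + y \<in> R"
    and uminus_closed: "x \<in> R \<Longrightarrow> - x \<in> R"
    and mult_closed: "x \<in> R \<Longrightarrow> y \<in> R \<Longrightarrow> x * y \<in> R"
    and valuation: "x \<in> R \<or> inverse x \<in> R"
    and half_notin: "inverse 2 \<notin> R"
    and archimedean: "\<exists>n. 2 ^ n * x \<in> R"
    and finite_mod_two: "\<exists>F. finite F \<and> (\<forall>x\<in>R. \<exists>r\<in>F. \<exists>y\<in>R. x - r = 2 * y)"
    and complete: "(\<And>n. f n \<in> R) \<Longrightarrow>
      \<exists>s\<in>R. \<forall>n. \<exists>t\<in>R. s - (\<Sum>i<n. 2 ^ i * f i) = 2 ^ n * t"
    and prime: "prime_in R \<pi>"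
begin

section \<open>Units and congruence modulo \<pi>\<close>

lemma zero_closed: "0 \<in> R"
  using add_closed[OF one_closed uminus_closed[OF one_closed]] by simp

lemma diff_closed: "x \<in> R \<Longrightarrow> y \<in> R \<Longrightarrow> x - y \<in> R"
  using add_closed[OF _ uminus_closed, of x y] by simp

lemma power_closed: "x \<in> R \<Longrightarrow> x ^ n \<in> R"
  by (induction n) (auto intro: one_closed mult_closed)

lemma of_nat_closed: "of_nat n \<in> R"
  by (induction n) (auto intro: one_closed zero_closed add_closed)

lemma numeral_closed: "numeral n \<in> R"
  using of_nat_closed[of "numeral n"] by simp

lemma pi_closed: "\<pi> \<in> R" and pi_nonzero: "\<pi> \<noteq> 0"
  using prime by (auto simp: prime_in_def)

lemmas closed = one_closed zero_closed add_closed uminus_closed mult_closed diff_closed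
  power_closed numeral_closed pi_closed

definition U :: "'k set" where "U = units_in R"

lemma U_iff: "u \<in> U \<longleftrightarrow> u \<noteq> 0 \<and> u \<in> R \<and> inverse u \<in> R"
proof -
  have "u \<in> U \<longleftrightarrow> u \<in> R \<and> (\<exists>c\<in>R. 1 = u * c)"
    by (simp add: U_def units_in_def divides_in_def)
  also have "\<dots> \<longleftrightarrow> u \<noteq> 0 \<and> u \<in> R \<and> inverse u \<in> R"
    by (metis inverse_unique mult_zero_left right_inverse zero_neq_one)
  finally show ?thesis .
qed

lemma U_closed: "u \<in> U \<Longrightarrow> u \<in> R" and U_nonzero: "u \<in> U \<Longrightarrow> u \<noteq> 0"
  and U_inverse_closed: "u \<in> U \<Longrightarrow> inverse u \<in> R"
  by (simp_all add: U_iff)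

lemma U_divide_closed: "x \<in> R \<Longrightarrow> u \<in> U \<Longrightarrow> x / u \<in> R"
  by (simp add: divide_inverse U_iff mult_closed)

lemma one_in_U: "1 \<in> U"
  by (simp add: U_iff one_closed)

lemma U_mult: "u \<in> U \<Longrightarrow> v \<in> U \<Longrightarrow> u * v \<in> U"
  by (simp add: U_iff mult_closed)

lemma U_inverse: "u \<in> U \<Longrightarrow> inverse u \<in> U"
  by (simp add: U_iff)

lemma U_uminus: "u \<in> U \<Longrightarrow> - u \<in> U"
  by (simp add: U_iff uminus_closed)

lemma U_power: "u \<in> U \<Longrightarrow> u ^ n \<in> U"
  by (induction n) (auto intro: one_in_U U_mult)

lemma two_nonzero: "(2 :: 'k) \<noteq> 0"
  using half_notin zero_closed by auto

lemma two_notin_U: "2 \<notin> U"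
  using half_notin by (simp add: U_iff)

lemma pi_notin_U: "\<pi> \<notin> U"
  using prime by (simp add: prime_in_def U_def)

text \<open>Equality in the residue field. Only the difference has to lie in the ideal, so
  membership of the arguments in \<open>R\<close> appears as a separate hypothesis below.\<close>

definition cong :: "'k \<Rightarrow> 'k \<Rightarrow> bool" (infix \<open>\<sim>\<close> 50) where
  "x \<sim> y \<longleftrightarrow> (\<exists>z\<in>R. x - y = \<pi> * z)"

lemma U_mult_left_dest: "x \<in> R \<Longrightarrow> y \<in> R \<Longrightarrow> x * y \<in> U \<Longrightarrow> x \<in> U"
proof -
  assume xy: "x \<in> R" "y \<in> R" "x * y \<in> U"
  hence "y * inverse (x * y) \<in> R" by (auto simp: U_iff intro: mult_closed)
  thus ?thesis using xy by (simp add: U_iff field_simps)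
qed

text \<open>\<pi> generates the ideal of nonunits. If x / \<pi> is not in \<open>R\<close>, then
  \<pi> is the product of x and \<pi> / x in \<open>R\<close>; by primality \<pi> divides one of
  them, and if it divides \<pi> / x then x is a unit.\<close>

lemma cong_zero_iff: 
  assumes x: "x \<in> R"
  shows "x \<sim> 0 \<longleftrightarrow> x \<notin> U"
proof
  assume "x \<sim> 0"
  then obtain z where "z \<in> R" "x = \<pi> * z" by (auto simp: cong_def)
  thus "x \<notin> U" using pi_notin_U U_mult_left_dest pi_closed by blast
next
  assume xU: "x \<notin> U"
  show "x \<sim> 0"
  proof (cases "x = 0 \<or> x / \<pi> \<in> R")
    case True
    hence "x / \<pi> \<in> R" by (auto simp: zero_closed)
    thus ?thesis using pi_nonzero by (auto simp: cong_def intro!: bexI[of _ "x / \<pi>"])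
  next
    case False
    hence y: "\<pi> / x \<in> R" and x0: "x \<noteq> 0" using valuation[of "x / \<pi>"] by auto
    have "divides_in R \<pi> (x * (\<pi> / x))"
      using x0 by (auto simp: divides_in_def intro!: bexI[of _ 1] one_closed)
    hence "divides_in R \<pi> x \<or> divides_in R \<pi> (\<pi> / x)"
      using prime x y by (auto simp: prime_in_def)
    thus ?thesis
    proof
      assume "divides_in R \<pi> x"
      thus ?thesis by (auto simp: cong_def divides_in_def)
    next
      assume "divides_in R \<pi> (\<pi> / x)"
      then obtain c where c: "c \<in> R" "\<pi> / x = \<pi> * c" by (auto simp: divides_in_def)
      hence "inverse x = c" using pi_nonzero by (auto simp: divide_inverse)
      thus ?thesis using c x x0 xU by (auto simp: U_iff)
    qed
  qed
qed

lemma nonunitE: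
  assumes "x \<in> R" "x \<notin> U"
  obtains y where "y \<in> R" "x = \<pi> * y"
  using assms cong_zero_iff[of x] by (auto simp: cong_def)

lemma cong_refl: "x \<sim> x"
  by (auto simp: cong_def intro!: bexI[of _ 0] zero_closed)

lemma cong_sym: "x \<sim> y \<Longrightarrow> y \<sim> x"
  unfolding cong_def by (metis minus_diff_eq mult_minus_right uminus_closed)

lemma cong_add: "x \<sim> y \<Longrightarrow> x' \<sim> y' \<Longrightarrow> x + x' \<sim> y + y'"
  unfolding cong_def by (metis add_closed add_diff_add distrib_left)

lemma cong_trans [trans]: "x \<sim> y \<Longrightarrow> y \<sim> z \<Longrightarrow> x \<sim> z"
  unfolding cong_def by (metis add_closed distrib_left diff_add_cancel add_diff_eq)

lemma cong_mult_left: "x \<sim> y \<Longrightarrow> a \<in> R \<Longrightarrow> a * x \<sim> a * y"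
  unfolding cong_def by (metis mult_closed right_diff_distrib mult.left_commute)

lemma cong_uminus: "x \<sim> y \<Longrightarrow> - x \<sim> - y"
  using cong_mult_left[of x y "- 1"] by (simp add: closed)

lemma cong_diff: "x \<sim> y \<Longrightarrow> x' \<sim> y' \<Longrightarrow> x - x' \<sim> y - y'"
  using cong_add[OF _ cong_uminus, of x y x' y'] by simp

lemma cong_iff_diff: "x \<sim> y \<longleftrightarrow> x - y \<sim> 0"
  by (simp add: cong_def)

lemma pi_mult_cong: "z \<in> R \<Longrightarrow> \<pi> * z \<sim> 0"
  by (auto simp: cong_def)

lemma two_cong: "2 \<sim> 0"
  by (simp add: cong_zero_iff numeral_closed two_notin_U)

lemma two_mult_cong: "z \<in> R \<Longrightarrow> 2 * z \<sim> 0"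
  using cong_mult_left[OF two_cong, of z] by (simp add: mult.commute)

lemma one_not_cong: "\<not> 1 \<sim> 0"
  using cong_zero_iff one_in_U one_closed by blast

lemma U_cong: "x \<sim> y \<Longrightarrow> y \<in> U \<Longrightarrow> x \<in> U"
proof -
  assume *: "x \<sim> y" "y \<in> U"
  then obtain z where "z \<in> R" "x = y + \<pi> * z" by (auto simp: cong_def algebra_simps)
  hence "x \<in> R" using * by (auto intro!: closed simp: U_iff)
  moreover have "\<not> x \<sim> 0" using * cong_zero_iff[of y] U_closed cong_trans cong_sym by blast
  ultimately show ?thesis using cong_zero_iff by blast
qed

lemma cong_mult_zeroD: "x \<in> R \<Longrightarrow> y \<in> R \<Longrightarrow> x * y \<sim> 0 \<Longrightarrow> x \<sim> 0 \<or> y \<sim> 0"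
  using cong_zero_iff mult_closed U_mult by blast

lemma cong_power2_zeroD: "x \<in> R \<Longrightarrow> x\<^sup>2 \<sim> 0 \<Longrightarrow> x \<sim> 0"
  using cong_mult_zeroD[of x x] by (simp add: power2_eq_square)

section \<open>The residue field, modelled by chosen representatives\<close>

definition res :: "'k \<Rightarrow> 'k" where
  "res x = (SOME y. y \<in> R \<and> y \<sim> x)"

lemma res: "x \<in> R \<Longrightarrow> res x \<in> R \<and> res x \<sim> x"
  unfolding res_def by (rule someI[of _ x]) (simp add: cong_refl)

lemma res_eq: "x \<sim> y \<Longrightarrow> res x = res y"
  unfolding res_def by (metis cong_sym cong_trans)

lemma res_eq_iff: "x \<in> R \<Longrightarrow> y \<in> R \<Longrightarrow> res x = res y \<longleftrightarrow> x \<sim> y"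
  using res res_eq cong_trans cong_sym by metis

lemma finite_res: "finite (res ` R)"
proof -
  obtain F where F: "finite F" "\<forall>x\<in>R. \<exists>r\<in>F. \<exists>y\<in>R. x - r = 2 * y"
    using finite_mod_two by blast
  have "res ` R \<subseteq> res ` F"
  proof
    fix z assume "z \<in> res ` R"
    then obtain x where x: "x \<in> R" "z = res x" by blast
    then obtain r y where "r \<in> F" "y \<in> R" "x - r = 2 * y" using F by blast
    hence "x \<sim> r" using two_mult_cong cong_iff_diff by metis
    thus "z \<in> res ` F" using x \<open>r \<in> F\<close> res_eq by blast
  qed
  thus ?thesis using F finite_surj by blast
qed

lemma res_idem: "x \<in> R \<Longrightarrow> res (res x) = res x"
  using res res_eq by blast

text \<open>Frobenius is injective on the residue field of characteristic 2, hence surjective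
  because the field is finite.\<close>

lemma res_square_root:
  assumes "x \<in> R"
  obtains c where "c \<in> R" "c\<^sup>2 \<sim> x"
proof -
  let ?f = "\<lambda>x. res (x\<^sup>2)"
  have "inj_on ?f (res ` R)"
  proof (rule inj_onI, clarify)
    fix x y assume xy: "x \<in> R" "y \<in> R" and eq: "res ((res x)\<^sup>2) = res ((res y)\<^sup>2)"
    let ?x = "res x" and ?y = "res y"
    have R: "?x \<in> R" "?y \<in> R" using xy res by auto
    hence "?x\<^sup>2 \<sim> ?y\<^sup>2" using eq by (simp add: res_eq_iff closed)
    hence "?x\<^sup>2 - ?y\<^sup>2 \<sim> 0" using cong_iff_diff by blast
    \<comment> \<open>In characteristic 2 the difference of the squares is the square of the
      difference; the subtracted term is the correction in \<open>R\<close>.\<close>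
    hence "(?x\<^sup>2 - ?y\<^sup>2) - 2 * (?y * (?x - ?y)) \<sim> 0 - 0"
      by (intro cong_diff two_mult_cong closed R)
    moreover have "(?x\<^sup>2 - ?y\<^sup>2) - 2 * (?y * (?x - ?y)) = (?x - ?y)\<^sup>2"
      by (simp add: power2_eq_square algebra_simps)
    ultimately have "?x - ?y \<sim> 0" using R by (auto intro: cong_power2_zeroD closed)
    hence "res ?x = res ?y" using cong_iff_diff res_eq by metis
    thus "?x = ?y" using xy by (simp add: res_idem)
  qed
  moreover have "?f ` res ` R \<subseteq> res ` R" using res by (auto intro!: imageI power_closed)
  ultimately have "?f ` res ` R = res ` R"
    by (intro endo_inj_surj finite_res)
  then obtain c where "c \<in> R" "res x = res ((res c)\<^sup>2)"
    using assms by blast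
  thus thesis using that[of "res c"] assms res closed res_eq_iff by metis
qed

text \<open>The map y^2 + y takes the value 0 at both 0 and 1, so on the finite residue field it is
  not injective and therefore not surjective.\<close>

lemma artin_schreier_nonsurjective:
  obtains \<rho> where "\<rho> \<in> R" "\<And>y. y \<in> R \<Longrightarrow> \<not> y\<^sup>2 + y \<sim> \<rho>"
proof -
  let ?f = "\<lambda>x. res (x\<^sup>2 + x)"
  have r: "res 0 \<in> R" "res 0 \<sim> 0" "res 1 \<in> R" "res 1 \<sim> 1"
    using res closed by auto
  have *: "x\<^sup>2 + x \<sim> a\<^sup>2 + a" if "x \<sim> a" "x \<in> R" "a \<in> R" for x a
  proof -
    have "(x + a + 1) * (x - a) \<sim> (x + a + 1) * 0"
      using that cong_iff_diff by (intro cong_mult_left closed) auto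
    moreover have "(x + a + 1) * (x - a) = (x\<^sup>2 + x) - (a\<^sup>2 + a)"
      by (simp add: power2_eq_square algebra_simps)
    ultimately show ?thesis using cong_iff_diff by simp
  qed
  have "\<not> inj_on ?f (res ` R)"
  proof
    assume inj: "inj_on ?f (res ` R)"
    have "(res 0)\<^sup>2 + res 0 \<sim> 0" using *[of "res 0" 0] r closed by simp
    also have "0 \<sim> 2" using two_cong cong_sym by blast
    also have "2 \<sim> (res 1)\<^sup>2 + res 1"
      using *[of "res 1" 1] r closed cong_sym by simp
    finally have "?f (res 0) = ?f (res 1)" by (rule res_eq)
    hence "res 0 = res 1" using inj closed by (auto dest: inj_onD)
    hence "0 \<sim> 1" using res_eq_iff closed by blast
    thus False using one_not_cong cong_sym by blast
  qed
  hence "\<not> res ` R \<subseteq> ?f ` res ` R" using finite_surj_inj[OF finite_res] by blast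
  then obtain x where x: "x \<in> R" "res x \<notin> ?f ` res ` R" by blast
  have "\<not> y\<^sup>2 + y \<sim> x" if "y \<in> R" for y
  proof
    assume "y\<^sup>2 + y \<sim> x"
    moreover have "(res y)\<^sup>2 + res y \<sim> y\<^sup>2 + y" using *[of "res y" y] that res by blast
    ultimately have "res x = ?f (res y)" using res_eq cong_trans by metis
    thus False using x that by blast
  qed
  thus thesis using that x by blast
qed

section \<open>The ramification index and valuations of elements\<close>

definition e :: nat where
  "e = (GREATEST n. divides_in R (\<pi> ^ n) 2)"

text \<open>Pigeonhole: two powers of \<pi> with exponents i < j agree modulo 2. Their difference is
  \<pi>^i times the unit 1 - \<pi>^(j - i).\<close>

lemma two_divides_pi_power: "\<exists>i. \<exists>y\<in>R. \<pi> ^ i = 2 * y"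
proof -
  obtain F where F: "finite F" "\<forall>x\<in>R. \<exists>r\<in>F. \<exists>y\<in>R. x - r = 2 * y"
    using finite_mod_two by blast
  hence "\<forall>n. \<exists>r. r \<in> F \<and> (\<exists>y\<in>R. \<pi> ^ n - r = 2 * y)"
    using power_closed[OF pi_closed] by blast
  then obtain g where g: "\<And>n. g n \<in> F \<and> (\<exists>y\<in>R. \<pi> ^ n - g n = 2 * y)"
    by (auto simp: choice_iff)
  hence "finite (range g)" using F finite_subset[of "range g" F] by blast
  hence "\<not> inj g" using finite_imageD[of g UNIV] by auto
  then obtain i j :: nat where ij: "i < j" "g i = g j"
    by (metis injI linorder_neqE_nat)
  obtain y z where yz: "y \<in> R" "z \<in> R" "\<pi> ^ i - g i = 2 * y" "\<pi> ^ j - g j = 2 * z"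
    using g by meson
  define u where "u = 1 - \<pi> ^ (j - i)"
  have "j - i = Suc (j - i - 1)" using ij by simp
  hence "u - 1 = \<pi> * - (\<pi> ^ (j - i - 1))" unfolding u_def by (metis power_Suc diff_diff_eq2 diff_add_cancel minus_diff_eq mult_minus_right add_diff_cancel_left' add.commute)
  hence "u \<sim> 1"
    unfolding cong_def by (rule bexI) (intro closed)
  hence u: "u \<in> U" by (rule U_cong) (rule one_in_U)
  have "\<pi> ^ i * u = \<pi> ^ i - \<pi> ^ j"
    using ij by (simp add: u_def right_diff_distrib flip: power_add)
  also have "\<dots> = 2 * (y - z)"
    using yz ij by (simp add: right_diff_distrib) (metis add_diff_cancel_left' diff_diff_eq2 diff_add_cancel)
  finally have "\<pi> ^ i * u = 2 * (y - z)" .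
  hence "\<pi> ^ i = 2 * ((y - z) / u)" using U_nonzero[OF u] by (simp add: field_simps)
  thus ?thesis using U_divide_closed[OF diff_closed u] yz by blast
qed

lemma pi_power_not_divides_one: "c \<in> R \<Longrightarrow> 0 < n \<Longrightarrow> \<pi> ^ n * c \<noteq> 1"
proof
  assume "c \<in> R" "0 < n" "\<pi> ^ n * c = 1"
  hence "\<pi> * (\<pi> ^ (n - 1) * c) \<in> U" by (metis one_in_U mult.assoc power_eq_if not_gr_zero)
  moreover have "\<pi> ^ (n - 1) * c \<in> R" using \<open>c \<in> R\<close> by (intro closed)
  ultimately show False using U_mult_left_dest[OF pi_closed] pi_notin_U by blast
qed

text \<open>Boundedness gives the greatest exponent in the definition of \<open>e\<close> its
  meaning. If 2 divides \<pi>^i and \<pi>^n divides 2 with n > i, a positive power of \<pi> would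
  divide 1.\<close>

lemma pi_power_divides_two_bounded: "\<exists>i. \<forall>n. divides_in R (\<pi> ^ n) 2 \<longrightarrow> n \<le> i"
proof -
  obtain i y where i: "y \<in> R" "\<pi> ^ i = 2 * y" using two_divides_pi_power by blast
  have "n \<le> i" if n2: "divides_in R (\<pi> ^ n) 2" for n
  proof (rule ccontr)
    assume n: "\<not> n \<le> i"
    obtain c where c: "c \<in> R" "2 = \<pi> ^ n * c" using n2 unfolding divides_in_def by blast
    have "\<pi> ^ i = \<pi> ^ n * (c * y)" using i c by simp
    also have "\<pi> ^ n = \<pi> ^ i * \<pi> ^ (n - i)" using n by (simp flip: power_add)
    finally have "\<pi> ^ (n - i) * (c * y) = 1" using pi_nonzero by simp
    thus False using pi_power_not_divides_one[of "c * y" "n - i"] n i c closed by auto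
  qed
  thus ?thesis by blast
qed

lemma two_eqE:
  obtains \<epsilon> where "\<epsilon> \<in> U" "2 = \<pi> ^ e * \<epsilon>"
proof -
  let ?P = "\<lambda>n. divides_in R (\<pi> ^ n) 2"
  obtain i where i: "\<forall>n. ?P n \<longrightarrow> n \<le> i" using pi_power_divides_two_bounded by blast
  have "?P 0" using closed by (auto simp: divides_in_def)
  hence "?P e" unfolding e_def by (rule GreatestI_nat) (use i in auto)
  then obtain \<epsilon> where \<epsilon>: "\<epsilon> \<in> R" "2 = \<pi> ^ e * \<epsilon>" unfolding divides_in_def by blast
  have "\<epsilon> \<in> U"
  proof (rule ccontr)
    assume "\<epsilon> \<notin> U"
    then obtain y where "y \<in> R" "\<epsilon> = \<pi> * y" using nonunitE \<epsilon> by blast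
    moreover have "2 = \<pi> ^ Suc e * y" using \<epsilon>(2) calculation by (simp add: mult_ac)
    ultimately have "?P (Suc e)" unfolding divides_in_def by blast
    hence "Suc e \<le> e" unfolding e_def by (rule Greatest_le_nat) (use i in auto)
    thus False by simp
  qed
  thus thesis using that \<epsilon> by blast
qed

lemma e_pos: "0 < e"
  using two_eqE two_notin_U by (metis gr0I mult_1 power_0)

text \<open>Every nonzero element is a unit times an integral power of \<pi>; the factor on the left
  accounts for negative exponents. A power of 2 moves x to y in \<open>R\<close>, and since y
  divides some 2^m, the exponent of \<pi> in y is at most \<open>e * m\<close>.\<close>

lemma unit_decomposition:
  assumes "x \<noteq> 0"
  obtains u i j where "u \<in> U" "\<pi> ^ i * x = \<pi> ^ j * u"
proof -
  obtain \<epsilon> where \<epsilon>: "\<epsilon> \<in> U" "2 = \<pi> ^ e * \<epsilon>" by (rule two_eqE)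
  obtain n where n: "2 ^ n * x \<in> R" using archimedean by blast
  obtain m where m: "2 ^ m * inverse (2 ^ n * x) \<in> R" using archimedean by blast
  define y where "y = 2 ^ n * x"
  have y: "y \<in> R" "y \<noteq> 0" using n assms two_nonzero by (auto simp: y_def)
  let ?P = "\<lambda>k. divides_in R (\<pi> ^ k) y"
  have "k \<le> e * m" if k: "?P k" for k
  proof (rule ccontr)
    assume km: "\<not> k \<le> e * m"
    obtain c where c: "c \<in> R" "y = \<pi> ^ k * c" using k by (auto simp: divides_in_def)
    have "2 ^ m = y * (2 ^ m * inverse y)" using y by simp
    also have "\<dots> = \<pi> ^ k * (c * (2 ^ m * inverse y))" using c by simp
    also have "\<pi> ^ k = \<pi> ^ (e * m) * \<pi> ^ (k - e * m)" using km by (simp flip: power_add)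
    finally have "\<epsilon> ^ m = \<pi> ^ (k - e * m) * (c * (2 ^ m * inverse y))"
      using pi_nonzero by (subst (asm) (1) \<epsilon>(2)) (simp add: power_mult_distrib power_mult mult.assoc)
    hence "\<pi> ^ (k - e * m) * (c * (2 ^ m * inverse y) * inverse (\<epsilon> ^ m)) = 1"
      using U_nonzero[OF \<epsilon>(1)] by (metis mult.assoc right_inverse power_not_zero)
    moreover have "c * (2 ^ m * inverse y) * inverse (\<epsilon> ^ m) \<in> R"
      using c m U_inverse_closed[OF U_power[OF \<epsilon>(1)]] by (simp add: y_def mult_closed del: inverse_mult_distrib)
    ultimately show False using pi_power_not_divides_one km by (metis not_le zero_less_diff)
  qed
  hence bound: "\<forall>k. ?P k \<longrightarrow> k \<le> e * m" by blast
  have "?P 0" using y by (auto simp: divides_in_def)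
  hence g: "?P (Greatest ?P)"
    by (rule GreatestI_nat[where P = ?P and b = "e * m"]) (use bound in blast)
  have g': "k \<le> Greatest ?P" if "?P k" for k
    using that by (rule Greatest_le_nat[where P = ?P and b = "e * m"]) (use bound in blast)
  define j where "j = Greatest ?P"
  obtain u where u: "u \<in> R" "y = \<pi> ^ j * u" using g by (auto simp: divides_in_def j_def)
  have "u \<in> U"
  proof (rule ccontr)
    assume "u \<notin> U"
    then obtain z where "z \<in> R" "u = \<pi> * z" using nonunitE u by blast
    hence "?P (Suc j)" using u by (auto simp: divides_in_def intro!: bexI[of _ z])
    thus False using g' j_def by fastforce
  qed
  moreover have "\<pi> ^ (e * n) * x = \<pi> ^ j * (u / \<epsilon> ^ n)"
  proof -
    have "\<pi> ^ (e * n) * \<epsilon> ^ n * x = \<pi> ^ j * u"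
      using u(2) unfolding y_def by (subst (asm) \<epsilon>(2)) (simp add: power_mult_distrib power_mult)
    thus ?thesis using U_nonzero[OF \<epsilon>(1)] by (simp add: field_simps)
  qed
  moreover have "u / \<epsilon> ^ n \<in> U" using U_mult U_inverse U_power \<epsilon> \<open>u \<in> U\<close> by (simp add: divide_inverse del: power_inverse)
  ultimately show thesis using that by blast
qed

section \<open>Hensel's lemma for quadratic polynomials\<close>

lemma separated:
  assumes "\<And>n. \<exists>t\<in>R. x = 2 ^ n * t"
  shows "x = 0"
proof (rule ccontr)
  assume x: "x \<noteq> 0"
  obtain n where n: "2 ^ n * inverse x \<in> R" using archimedean by blast
  obtain t where t: "t \<in> R" "x = 2 ^ Suc n * t" using assms by blast
  have "inverse 2 = t * (2 ^ n * inverse x)" using t x two_nonzero by (auto simp: field_simps)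
  thus False using half_notin n t mult_closed by metis
qed

text \<open>The right side is a contraction in h: its values at h and h' differ by \<pi> \<beta> (h
  + h') (h - h'). Iteration from 0 converges to a fixed point.\<close>

lemma hensel_contraction:
  assumes "\<alpha> \<in> R" "\<beta> \<in> R"
  obtains h where "h \<in> R" "h = \<alpha> + \<pi> * \<beta> * h\<^sup>2"
proof -
  obtain \<epsilon> where \<epsilon>: "\<epsilon> \<in> U" "2 = \<pi> ^ e * \<epsilon>" by (rule two_eqE)
  define \<phi> where "\<phi> h = \<alpha> + \<pi> * \<beta> * h\<^sup>2" for h
  define x where "x n = (\<phi> ^^ n) 0" for n
  have x: "x n \<in> R" for n
    by (induction n) (simp_all add: x_def, auto simp: \<phi>_def intro!: closed assms)
  have step: "\<exists>z\<in>R. x (Suc n) - x n = \<pi> ^ n * z" for n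
  proof (induction n)
    case 0
    have "x 1 - x 0 \<in> R" by (intro closed x)
    thus ?case by simp
  next
    case (Suc n)
    then obtain z where z: "z \<in> R" "x (Suc n) - x n = \<pi> ^ n * z" by blast
    have "x (Suc (Suc n)) - x (Suc n) = \<phi> (x (Suc n)) - \<phi> (x n)"
      by (simp add: x_def)
    also have "\<dots> = \<pi> * \<beta> * (x (Suc n) + x n) * (x (Suc n) - x n)"
      by (simp add: \<phi>_def power2_eq_square algebra_simps)
    also have "\<dots> = \<pi> ^ Suc n * (\<beta> * (x (Suc n) + x n) * z)" using z by simp
    finally show ?case using z x assms closed by (metis (no_types, lifting))
  qed
  have steps: "\<exists>z\<in>R. x (n + k) - x n = \<pi> ^ n * z" for n k
  proof (induction k)
    case (Suc k)
    then obtain z where z: "z \<in> R" "x (n + k) - x n = \<pi> ^ n * z" by blast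
    obtain w where w: "w \<in> R" "x (Suc (n + k)) - x (n + k) = \<pi> ^ (n + k) * w" using step by blast
    have "x (n + Suc k) - x n = (x (Suc (n + k)) - x (n + k)) + (x (n + k) - x n)" by simp
    also have "\<dots> = \<pi> ^ n * (\<pi> ^ k * w + z)" unfolding z w by (simp add: algebra_simps power_add)
    finally show ?case using z w closed by (metis (no_types, lifting))
  qed (auto intro!: bexI[of _ 0] zero_closed)
  \<comment> \<open>Only every e-th iterate is kept: \<pi>^(e n) is 2^n times a unit, so the
    differences of the subsequence form a 2-adic series to which \<open>complete\<close>
    applies.\<close>
  define y where "y n = x (e * n)" for n
  have pow: "\<pi> ^ (e * n) = 2 ^ n * inverse (\<epsilon> ^ n)" for n
    using U_nonzero[OF \<epsilon>(1)] by (subst \<epsilon>(2)) (simp add: power_mult_distrib power_mult)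
  have to2: "\<exists>t\<in>R. \<pi> ^ (e * n) * z = 2 ^ n * t" if "z \<in> R" for n z
    using that pow U_inverse_closed[OF U_power[OF \<epsilon>(1)]] mult_closed by (metis mult.assoc)
  have "\<exists>t\<in>R. y (Suc n) - y n = 2 ^ n * t" for n
    using steps[of "e * n" e] to2[of _ n] by (auto simp: y_def add.commute)
  then obtain f where f: "\<And>n. f n \<in> R" "\<And>n. y (Suc n) - y n = 2 ^ n * f n"
    by metis
  obtain s where s: "s \<in> R" "\<And>n. \<exists>t\<in>R. s - (\<Sum>i<n. 2 ^ i * f i) = 2 ^ n * t"
    using complete[of f] f by blast
  have sum: "(\<Sum>i<n. 2 ^ i * f i) = y n" for n
    using sum_lessThan_telescope[of y n] f by (simp add: y_def x_def)
  have "s - \<phi> s = 0"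
  proof (rule separated)
    fix n
    obtain t where t: "t \<in> R" "s - y n = 2 ^ n * t" using s(2)[of n] sum by auto
    obtain z where z: "z \<in> R" "x (Suc (e * n)) - x (e * n) = \<pi> ^ (e * n) * z" using step by blast
    obtain w where w: "w \<in> R" "\<pi> ^ (e * n) * z = 2 ^ n * w" using to2 z by blast
    have yR: "y n \<in> R" by (simp add: y_def x)
    have "s - \<phi> s = (s - y n) - (\<phi> (y n) - y n) - (\<phi> s - \<phi> (y n))" by simp
    also have "\<phi> (y n) - y n = 2 ^ n * w" using z w by (simp add: y_def x_def)
    also have "\<phi> s - \<phi> (y n) = \<pi> * \<beta> * (s + y n) * (s - y n)"
      by (simp add: \<phi>_def power2_eq_square algebra_simps)
    also have "(s - y n) - 2 ^ n * w - \<pi> * \<beta> * (s + y n) * (s - y n) =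
        2 ^ n * (t - w - \<pi> * \<beta> * (s + y n) * t)"
      unfolding t(2) by (simp add: algebra_simps)
    finally show "\<exists>t\<in>R. s - \<phi> s = 2 ^ n * t"
      by (rule bexI) (use t w yR s assms in \<open>intro closed; simp\<close>)
  qed
  thus thesis using that[of s] s by (simp add: \<phi>_def)
qed

text \<open>With d the derivative at the approximate root, the ansatz of adding \<pi> h to that
  root, followed by division by \<pi> d, gives the fixed-point equation of
  \<open>hensel_contraction\<close>.\<close>

lemma hensel_quadratic:
  assumes R: "a \<in> R" "b \<in> R" "c \<in> R" "t\<^sub>0 \<in> R"
    and root: "a * t\<^sub>0\<^sup>2 + b * t\<^sub>0 + c \<sim> 0" and simple: "2 * a * t\<^sub>0 + b \<in> U"
  obtains t where "t \<in> R" "a * t\<^sup>2 + b * t + c = 0"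
proof -
  define d where "d = 2 * a * t\<^sub>0 + b"
  have d: "d \<in> U" "d \<noteq> 0" using simple U_nonzero by (auto simp: d_def)
  obtain z where z: "z \<in> R" "a * t\<^sub>0\<^sup>2 + b * t\<^sub>0 + c = \<pi> * z" using root by (auto simp: cong_def)
  obtain h where h: "h \<in> R" "h = - z / d + \<pi> * (- a / d) * h\<^sup>2"
    using hensel_contraction[of "- z / d" "- a / d"] U_divide_closed z R d closed by metis
  have "a * (t\<^sub>0 + \<pi> * h)\<^sup>2 + b * (t\<^sub>0 + \<pi> * h) + c =
      (a * t\<^sub>0\<^sup>2 + b * t\<^sub>0 + c) + \<pi> * (d * h + \<pi> * a * h\<^sup>2)"
    by (simp add: d_def power2_eq_square algebra_simps)
  also have "d * h = - z - \<pi> * a * h\<^sup>2"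
  proof -
    have "d * h = d * (- z / d + \<pi> * (- a / d) * h\<^sup>2)" using h(2) by (rule arg_cong)
    also have "\<dots> = - z - \<pi> * a * h\<^sup>2" using d(2) by (simp add: right_diff_distrib)
    finally show ?thesis .
  qed
  also have "(a * t\<^sub>0\<^sup>2 + b * t\<^sub>0 + c) + \<pi> * (- z - \<pi> * a * h\<^sup>2 + \<pi> * a * h\<^sup>2) = 0"
    unfolding z(2) by simp
  finally show thesis by (rule that[rotated]) (intro closed R h(1))
qed

end

section \<open>The ring of integers\<close>

locale two_adic_order = two_adic_extension \<iota> for \<iota> :: "two_adic \<Rightarrow> 'k :: field" +
  fixes G :: "'k set"
  assumes finite_G: "finite G" and one_G: "1 \<in> G"
    and arch: "\<exists>m. 2 ^ m * x \<in> Z.span G"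
    and L_mult: "x \<in> Z.span G \<Longrightarrow> y \<in> Z.span G \<Longrightarrow> x * y \<in> Z.span G"
begin

abbreviation L :: "'k set" where "L \<equiv> Z.span G"

lemma L_one: "1 \<in> L"
  by (rule Z.span_base) (rule one_G)

lemma L_power: "x \<in> L \<Longrightarrow> x ^ n \<in> L"
  by (induction n) (auto intro: L_one L_mult)

lemma L_of_nat_mult: "x \<in> L \<Longrightarrow> of_nat n * x \<in> L"
  using Z.span_scale[of x G "of_nat n"] by (simp add: j.hom_of_nat)

lemma L_two_mult: "x \<in> L \<Longrightarrow> 2 * x \<in> L"
  using span_two_power[of x G 1] by simp

lemma L_finite_mod_two_power:
  "\<exists>F. finite F \<and> (\<forall>x\<in>L. \<exists>r\<in>F. \<exists>y\<in>L. x - r = 2 ^ n * y)"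
proof (induction n)
  case 0
  show ?case by (intro exI[of _ "{0}"]) simp
next
  case (Suc n)
  then obtain F where F: "finite F" "\<And>x. x \<in> L \<Longrightarrow> \<exists>r\<in>F. \<exists>y\<in>L. x - r = 2 ^ n * y" by blast
  obtain E where E: "finite E" "\<And>x. x \<in> L \<Longrightarrow> \<exists>r\<in>E. \<exists>y\<in>L. x - r = 2 * y"
    using span_finite_mod_two[OF finite_G] by blast
  define H where "H = (\<lambda>(r, q). r + 2 ^ n * q) ` (F \<times> E)"
  have "\<exists>r\<in>H. \<exists>y\<in>L. x - r = 2 ^ Suc n * y" if x: "x \<in> L" for x
  proof -
    obtain r y where r: "r \<in> F" "y \<in> L" "x - r = 2 ^ n * y" using F(2)[OF x] by blast
    obtain q z where q: "q \<in> E" "z \<in> L" "y - q = 2 * z" using E(2)[OF r(2)] by blast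
    have "x - (r + 2 ^ n * q) = 2 ^ n * (y - q)" using r(3) by (simp add: algebra_simps)
    also have "\<dots> = 2 ^ Suc n * z" using q by simp
    finally show ?thesis using r q unfolding H_def by force
  qed
  moreover have "finite H" using F E by (simp add: H_def)
  ultimately show ?case by blast
qed

section \<open>Integrality as boundedness of the powers with respect to \<open>L\<close>\<close>

definition power_bounded :: "'k \<Rightarrow> bool" where
  "power_bounded x \<longleftrightarrow> (\<exists>N. \<forall>n. 2 ^ N * x ^ n \<in> L)"

text \<open>The elements \<open>y\<close> with \<open>2\<^sup>N x\<^sup>n y \<in> L\<close> for all \<open>n\<close> form a lattice between \<open>L\<close>
  and \<open>2\<^sup>-\<^sup>N L\<close>, hence a finitely generated one, that is stable under \<open>x\<close>.\<close>

lemma power_bounded_imp_integral: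
  assumes "power_bounded x"
  shows "x \<in> integers \<iota>"
proof -
  obtain N where N: "\<And>n. 2 ^ N * x ^ n \<in> L" using assms by (auto simp: power_bounded_def)
  define M where "M = {y. \<forall>n. 2 ^ N * x ^ n * y \<in> L}"
  have M_diff: "a - b \<in> M" if "a \<in> M" "b \<in> M" for a b
    using that by (auto simp: M_def right_diff_distrib Z.span_diff)
  have L_sub: "L \<subseteq> M" using N by (auto simp: M_def intro: L_mult)
  have x_M: "x * y \<in> M" if "y \<in> M" for y
  proof -
    have "2 ^ N * x ^ n * (x * y) \<in> L" for n
      using that by (auto simp: M_def mult_ac dest: spec[of _ "Suc n"])
    thus ?thesis by (simp add: M_def)
  qed
  obtain F where F: "finite F" "\<And>x. x \<in> L \<Longrightarrow> \<exists>r\<in>F. \<exists>y\<in>L. x - r = 2 ^ N * y"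
    using L_finite_mod_two_power[of N] by blast
  \<comment> \<open>The classes in F represent all of \<open>L\<close> modulo 2^N \<open>L\<close>,
    not only 2^N M. \<open>rep r\<close> is a member of M whose multiple by 2^N lies in the class of
    r, if there is one; otherwise it is arbitrary, which is why \<open>G'\<close> intersects with
    M.\<close>
  define rep where "rep r = (SOME y. y \<in> M \<and> (\<exists>l\<in>L. 2 ^ N * y - r = 2 ^ N * l))" for r
  define G' where "G' = G \<union> (rep ` F \<inter> M)"
  have M_span: "y \<in> Z.span G'" if "y \<in> M" for y
  proof -
    have "2 ^ N * y \<in> L" using that by (auto simp: M_def dest: spec[of _ 0])
    then obtain r l where r: "r \<in> F" "l \<in> L" "2 ^ N * y - r = 2 ^ N * l" using F(2) by blast
    hence "rep r \<in> M \<and> (\<exists>l\<in>L. 2 ^ N * rep r - r = 2 ^ N * l)"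
      unfolding rep_def using that
      by (intro someI[of "\<lambda>y. y \<in> M \<and> (\<exists>l\<in>L. 2 ^ N * y - r = 2 ^ N * l)" y]) blast
    then obtain l' where l': "rep r \<in> M" "l' \<in> L" "2 ^ N * rep r - r = 2 ^ N * l'" by blast
    have "2 ^ N * (y - rep r) = 2 ^ N * (l - l')"
      using r(3) l'(3) by (simp add: algebra_simps)
    hence "y - rep r = l - l'" using two_nonzero by (simp only: mult_cancel_left power_not_zero) simp
    hence "y = rep r + (l - l')" by (simp add: algebra_simps)
    moreover have "rep r \<in> Z.span G'" using r l' by (auto simp: G'_def intro: Z.span_base)
    moreover have "l - l' \<in> Z.span G'"
      using Z.span_diff[OF r(2) l'(2)] Z.span_mono[of G G'] by (auto simp: G'_def)
    ultimately show ?thesis by (simp add: Z.span_add)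
  qed
  have G'M: "G' \<subseteq> M" using L_sub Z.span_superset[of G] by (auto simp: G'_def)
  show ?thesis
  proof (rule integersI[of G'])
    show "finite G'" using finite_G F(1) by (simp add: G'_def)
    show "1 \<in> G'" using one_G by (simp add: G'_def)
    show "x * g \<in> Z.span G'" if "g \<in> G'" for g using that G'M x_M M_span by blast
  qed
qed

text \<open>The monic equation of degree d expresses every power of x through lower ones with 2-adic
  integer coefficients, so a common denominator of the first d powers serves for all.\<close>

lemma integral_imp_power_bounded:
  assumes "x \<in> integers \<iota>"
  shows "power_bounded x"
proof -
  obtain p where p: "lead_coeff p = 1" "poly (map_poly j p) x = 0"
    using assms by (auto simp: integers_def j_def[abs_def])
  define d where "d = degree p"
  have deg: "degree (map_poly j p) = d"
    unfolding d_def by (rule degree_map_poly) (use p in \<open>auto simp: j_one\<close>)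
  have "(\<Sum>i<d. j (coeff p i) * x ^ i) + x ^ d = 0"
    using p by (simp add: poly_altdef deg coeff_map_poly j_zero j_one
        lessThan_Suc_atMost[symmetric] d_def)
  hence xd: "x ^ d = - (\<Sum>i<d. j (coeff p i) * x ^ i)" by (simp add: eq_neg_iff_add_eq_0 add.commute)
  have "\<forall>i. \<exists>m. 2 ^ m * x ^ i \<in> L" using arch by blast
  from choice[OF this] obtain m where m: "\<And>i. 2 ^ m i * x ^ i \<in> L" by blast
  define N where "N = Max (insert 0 (m ` {..<d}))"
  have N: "2 ^ N * x ^ n \<in> L" for n
  proof (induction n rule: less_induct)
    case (less n)
    show ?case
    proof (cases "n < d")
      case True
      hence "m n \<le> N" unfolding N_def by (intro Max_ge) auto
      thus ?thesis using span_two_power_mono[OF m] by blast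
    next
      case False
      hence "2 ^ N * x ^ n = 2 ^ N * (x ^ (n - d) * x ^ d)" by (simp flip: power_add)
      also have "\<dots> = - (\<Sum>i<d. j (coeff p i) * (2 ^ N * x ^ (n - d + i)))"
        unfolding xd by (simp add: sum_distrib_left power_add mult_ac)
      also have "\<dots> \<in> L"
        by (intro Z.span_neg Z.span_sum Z.span_scale less.IH) (use False in auto)
      finally show ?thesis .
    qed
  qed
  thus ?thesis by (auto simp: power_bounded_def)
qed

lemma integers_eq: "integers \<iota> = Collect power_bounded"
  using power_bounded_imp_integral integral_imp_power_bounded by blast

lemma integers_mult:
  assumes "x \<in> integers \<iota>" "y \<in> integers \<iota>"
  shows "x * y \<in> integers \<iota>"
proof -
  obtain N N' where N: "\<And>n. 2 ^ N * x ^ n \<in> L" "\<And>n. 2 ^ N' * y ^ n \<in> L"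
    using assms by (auto simp: integers_eq power_bounded_def)
  have "2 ^ (N + N') * (x * y) ^ n \<in> L" for n
    using L_mult[OF N(1)[of n] N(2)[of n]] by (simp add: power_add power_mult_distrib mult_ac)
  thus ?thesis by (auto simp: integers_eq power_bounded_def)
qed

text \<open>Binomial expansion: the exponents that bound the powers of x and of y add up to one for
  all mixed terms.\<close>

lemma integers_add:
  assumes "x \<in> integers \<iota>" "y \<in> integers \<iota>"
  shows "x + y \<in> integers \<iota>"
proof -
  obtain N N' where N: "\<And>n. 2 ^ N * x ^ n \<in> L" "\<And>n. 2 ^ N' * y ^ n \<in> L"
    using assms by (auto simp: integers_eq power_bounded_def)
  have "2 ^ (N + N') * (x + y) ^ n \<in> L" for n
  proof -
    have "2 ^ (N + N') * (x + y) ^ n =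
        (\<Sum>k\<le>n. of_nat (n choose k) * ((2 ^ N * x ^ k) * (2 ^ N' * y ^ (n - k))))"
      by (simp add: binomial_ring sum_distrib_left power_add mult_ac)
    also have "\<dots> \<in> L" by (intro Z.span_sum L_of_nat_mult L_mult N)
    finally show ?thesis .
  qed
  thus ?thesis by (auto simp: integers_eq power_bounded_def)
qed

lemma L_integers: "x \<in> L \<Longrightarrow> x \<in> integers \<iota>"
  by (auto simp: integers_eq power_bounded_def intro!: exI[of _ 0] L_power)

text \<open>If 1 + 2x vanished, 1/2 = -x would be integral. The geometric series for the inverse is
  cut after m terms; its tail lies in \<open>L\<close> once 2^m / (1 + 2x) does.\<close>

lemma L_inverse:
  assumes "x \<in> L"
  shows "1 + 2 * x \<noteq> 0" "inverse (1 + 2 * x) \<in> L"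
proof -
  show nz: "1 + 2 * x \<noteq> 0"
  proof
    assume "1 + 2 * x = 0"
    hence "2 * - x = 1" using minus_unique minus_minus mult_minus_right by metis
    hence "inverse 2 = - x" by (rule inverse_unique)
    thus False using half_notin_integers L_integers[OF Z.span_neg[OF assms]] by metis
  qed
  obtain m where m: "2 ^ m * inverse (1 + 2 * x) \<in> L" using arch by blast
  let ?q = "- 2 * x"
  have "1 - ?q ^ m = (1 + 2 * x) * (\<Sum>i<m. ?q ^ i)"
    using one_diff_power_eq[of ?q m] by simp
  hence "inverse (1 + 2 * x) * (1 - ?q ^ m) = (\<Sum>i<m. ?q ^ i)"
    using nz by (simp add: field_simps)
  hence "inverse (1 + 2 * x) = (\<Sum>i<m. ?q ^ i) + ?q ^ m * inverse (1 + 2 * x)"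
    by (simp only: right_diff_distrib mult_1_right diff_eq_eq mult.commute[of "?q ^ m"])
  also have "?q ^ m * inverse (1 + 2 * x) = (- x) ^ m * (2 ^ m * inverse (1 + 2 * x))"
    using power_mult_distrib[of 2 "- x" m] by (simp add: mult_ac)
  also have "(\<Sum>i<m. ?q ^ i) + \<dots> \<in> L"
  proof -
    have "?q \<in> L" using L_two_mult[OF Z.span_neg[OF assms]] by simp
    hence "(\<Sum>i<m. ?q ^ i) \<in> L" by (intro Z.span_sum L_power)
    moreover have "(- x) ^ m * (2 ^ m * inverse (1 + 2 * x)) \<in> L"
      by (rule L_mult[OF L_power[OF Z.span_neg[OF assms]] m])
    ultimately show ?thesis by (rule Z.span_add)
  qed
  finally show "inverse (1 + 2 * x) \<in> L" .
qed

section \<open>Compactness of \<open>L\<close>: \<open>bad\<close> sets are those without a uniform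
  exponent M\<close>

definition bad :: "'k set \<Rightarrow> bool" where
  "bad A \<longleftrightarrow> (\<forall>M. \<exists>y\<in>A. y \<in> L \<and> y \<notin> (*) 2 ` L \<and> (\<forall>z\<in>L. 2 ^ M \<noteq> y * z))"

definition coset :: "'k \<Rightarrow> nat \<Rightarrow> 'k set" where
  "coset c n = (\<lambda>l. c + 2 ^ n * l) ` L"

lemma bad_mono: "bad A \<Longrightarrow> A \<subseteq> B \<Longrightarrow> bad B"
  unfolding bad_def by blast

lemma bad_UN:
  assumes "finite I" "bad (\<Union>i\<in>I. A i)"
  shows "\<exists>i\<in>I. bad (A i)"
proof (rule ccontr)
  assume *: "\<not> ?thesis"
  have "\<exists>M. \<forall>y\<in>A i. y \<in> L \<longrightarrow> y \<notin> (*) 2 ` L \<longrightarrow> (\<exists>z\<in>L. 2 ^ M = y * z)" if "i \<in> I" for i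
  proof -
    have "\<not> bad (A i)" using * that by blast
    thus ?thesis unfolding bad_def by blast
  qed
  then obtain M where M: "\<And>i y. i \<in> I \<Longrightarrow> y \<in> A i \<Longrightarrow> y \<in> L \<Longrightarrow> y \<notin> (*) 2 ` L \<Longrightarrow>
      (\<exists>z\<in>L. 2 ^ M i = y * z)"
    by metis
  define N where "N = Max (insert 0 (M ` I))"
  obtain y where y: "y \<in> (\<Union>i\<in>I. A i)" "y \<in> L" "y \<notin> (*) 2 ` L" "\<forall>z\<in>L. 2 ^ N \<noteq> y * z"
    using assms(2) unfolding bad_def by blast
  then obtain i where i: "i \<in> I" "y \<in> A i" by blast
  then obtain z where z: "z \<in> L" "2 ^ M i = y * z" using M y by blast
  have "M i \<le> N" unfolding N_def using assms(1) i by (intro Max_ge) auto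
  hence "2 ^ N = 2 ^ (N - M i) * (2 :: 'k) ^ M i" by (simp flip: power_add)
  hence "2 ^ N = y * (2 ^ (N - M i) * z)" using z by (simp add: mult_ac)
  thus False using y(4) span_two_power[OF z(1)] by blast
qed

text \<open>A class modulo 2^n is covered by finitely many classes modulo 2^(n + 1), and finitely
  many exponents would have a maximum, so badness survives in one of them.\<close>

lemma bad_coset_refine:
  assumes "bad (coset c n)"
  shows "\<exists>g\<in>L. bad (coset (c + 2 ^ n * g) (Suc n))"
proof -
  obtain E where E: "finite E" "\<And>x. x \<in> L \<Longrightarrow> \<exists>r\<in>E. \<exists>y\<in>L. x - r = 2 * y"
    using span_finite_mod_two[OF finite_G] by blast
  have "coset c n \<subseteq> (\<Union>g\<in>E \<inter> L. coset (c + 2 ^ n * g) (Suc n))"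
  proof
    fix x assume "x \<in> coset c n"
    then obtain l where l: "l \<in> L" "x = c + 2 ^ n * l" by (auto simp: coset_def)
    then obtain r y where r: "r \<in> E" "y \<in> L" "l - r = 2 * y" using E(2) by blast
    have "r = l - 2 * y" using r(3) by (simp add: algebra_simps)
    hence "r \<in> L" using l(1) r(2) by (simp add: Z.span_diff L_two_mult)
    moreover have "x = (c + 2 ^ n * r) + 2 ^ Suc n * y"
      using l(2) r(3) by (simp add: algebra_simps)
    ultimately show "x \<in> (\<Union>g\<in>E \<inter> L. coset (c + 2 ^ n * g) (Suc n))"
      using r unfolding coset_def by blast
  qed
  hence "bad (\<Union>g\<in>E \<inter> L. coset (c + 2 ^ n * g) (Suc n))" using assms bad_mono by blast
  thus ?thesis using bad_UN[of "E \<inter> L"] E(1) by blast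
qed

text \<open>Compactness of \<open>L\<close>: nested bad cosets would shrink to a point \<open>s\<close>, but a divisor \<open>s\<close> of
  \<open>2\<^sup>m\<close> controls all of \<open>s + 2\<^sup>m\<^sup>+\<^sup>1 L\<close>.\<close>

lemma uniform_division:
  obtains M where "\<And>y. y \<in> L \<Longrightarrow> y \<notin> (*) 2 ` L \<Longrightarrow> \<exists>z\<in>L. 2 ^ M = y * z"
proof -
  have "\<not> bad L"
  proof
    assume "bad L"
    \<comment> \<open>The centres are chosen one after the other. The clause for n = 0 starts them
      at 0, so that c n is the n-th partial sum of a series with terms 2^i g i.\<close>
    have "\<exists>c. \<forall>n. (bad (coset (c n) n) \<and> (n = 0 \<longrightarrow> c n = 0)) \<and> (\<exists>g\<in>L. c (Suc n) = c n + 2 ^ n * g)"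
    proof (rule dependent_nat_choice)
      show "\<exists>c. bad (coset c 0) \<and> (0 = 0 \<longrightarrow> c = 0)"
        using \<open>bad L\<close> by (simp add: coset_def)
    next
      fix c n assume "bad (coset c n) \<and> (n = 0 \<longrightarrow> c = 0)"
      thus "\<exists>c'. (bad (coset c' (Suc n)) \<and> (Suc n = 0 \<longrightarrow> c' = 0)) \<and> (\<exists>g\<in>L. c' = c + 2 ^ n * g)"
        using bad_coset_refine by blast
    qed
    then obtain c where c: "\<And>n. bad (coset (c n) n)" "c 0 = 0"
        "\<And>n. \<exists>g\<in>L. c (Suc n) = c n + 2 ^ n * g"
      by blast
    obtain g where g: "\<And>n. g n \<in> L" "\<And>n. c (Suc n) = c n + 2 ^ n * g n" using c(3) by metis
    have sum: "(\<Sum>i<n. 2 ^ i * g i) = c n" for n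
      by (induction n) (simp_all add: c(2) g(2))
    obtain s where s: "s \<in> L" "\<And>n. \<exists>t\<in>L. s - c n = 2 ^ n * t"
      using span_complete[OF finite_G, of g] g(1) unfolding sum by blast
    have bad_s: "bad (coset s n)" for n
    proof (rule bad_mono[OF c(1)[of n]])
      obtain t where t: "t \<in> L" "s - c n = 2 ^ n * t" using s by blast
      have "c n + 2 ^ n * l = s + 2 ^ n * (l - t)" for l using t(2) by (simp add: algebra_simps)
      thus "coset (c n) n \<subseteq> coset s n" using t(1) by (auto simp: coset_def Z.span_diff)
    qed
    show False
    proof (cases "s \<in> (*) 2 ` L")
      case True
      then obtain t where t: "t \<in> L" "s = 2 * t" by blast
      \<comment> \<open>If s lies in 2 \<open>L\<close>, so does its whole class modulo 2, which
        then contains no element eligible for badness.\<close>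
      have "coset s 1 \<subseteq> (*) 2 ` L"
      proof
        fix x assume "x \<in> coset s 1"
        then obtain l where l: "l \<in> L" "x = s + 2 * l" by (auto simp: coset_def)
        hence "x = 2 * (t + l)" using t by (simp add: distrib_left)
        thus "x \<in> (*) 2 ` L" using Z.span_add[OF t(1) l(1)] by blast
      qed
      thus False using bad_s[of 1] unfolding bad_def by blast
    next
      case False
      hence s0: "s \<noteq> 0" using Z.span_zero by (auto simp: image_iff)
      obtain m where m: "2 ^ m * inverse s \<in> L" using arch by blast
      define z where "z = 2 ^ m * inverse s"
      have z: "z \<in> L" "s * z = 2 ^ m" using m s0 by (simp_all add: z_def)
      obtain y where y: "y \<in> coset s (Suc m)" "\<forall>z\<in>L. 2 ^ m \<noteq> y * z"
        using bad_s[of "Suc m"] unfolding bad_def by blast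
      obtain l where l: "l \<in> L" "y = s + 2 ^ Suc m * l" using y(1) by (auto simp: coset_def)
      have lz: "l * z \<in> L" using l z L_mult by blast
      have "y * z = 2 ^ m * (1 + 2 * (l * z))"
        unfolding l(2) distrib_right z(2) by (simp add: algebra_simps)
      hence "y * (z * inverse (1 + 2 * (l * z))) = 2 ^ m"
        using L_inverse(1)[OF lz] by (simp add: mult.assoc[symmetric])
      moreover have "z * inverse (1 + 2 * (l * z)) \<in> L"
        using z(1) L_inverse(2)[OF lz] by (rule L_mult)
      ultimately show False using y(2) by metis
    qed
  qed
  thus thesis using that unfolding bad_def by blast
qed

text \<open>Let m be minimal with y = 2^m x in \<open>L\<close>. Then m > M, and y is not in 2
  \<open>L\<close>, so 2^M = y z with z in \<open>L\<close> by \<open>uniform_division\<close>;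
  hence 1 / x = 2^(m - M) z with a positive exponent.\<close>

lemma large_inverse:
  obtains M where "\<And>x. 2 ^ M * x \<notin> L \<Longrightarrow> x \<noteq> 0 \<and> (\<exists>l\<in>L. inverse x = 2 * l)"
proof -
  obtain M where M: "\<And>y. y \<in> L \<Longrightarrow> y \<notin> (*) 2 ` L \<Longrightarrow> \<exists>z\<in>L. 2 ^ M = y * z"
    using uniform_division by blast
  have "x \<noteq> 0 \<and> (\<exists>l\<in>L. inverse x = 2 * l)" if x: "2 ^ M * x \<notin> L" for x
  proof -
    define m where "m = (LEAST m. 2 ^ m * x \<in> L)"
    have m: "2 ^ m * x \<in> L" unfolding m_def using arch by (rule LeastI_ex)
    have mM: "M < m" using x m span_two_power_mono by (metis not_le)
    have "2 ^ m * x \<notin> (*) 2 ` L"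
    proof
      assume "2 ^ m * x \<in> (*) 2 ` L"
      then obtain l where l: "l \<in> L" "2 ^ m * x = 2 * l" by blast
      obtain m' where m': "m = Suc m'" using mM by (cases m) auto
      have "2 ^ m' * x = l" using l(2) two_nonzero by (simp add: m')
      hence "m \<le> m'" unfolding m_def using l(1) by (intro Least_le) simp
      thus False by (simp add: m')
    qed
    then obtain z where z: "z \<in> L" "2 ^ M = 2 ^ m * x * z" using M[OF m] by blast
    have "2 ^ m = (2 :: 'k) ^ M * 2 ^ (m - M)" using mM by (simp flip: power_add)
    hence "1 = x * (2 ^ (m - M) * z)" using z(2) two_nonzero by (simp add: mult_ac)
    hence "x \<noteq> 0" "inverse x = 2 ^ (m - M) * z" by (auto intro: inverse_unique)
    moreover have "m - M = Suc (m - M - 1)" using mM by simp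
    hence "2 ^ (m - M) * z = 2 * (2 ^ (m - M - 1) * z)" by (metis mult.assoc power_Suc)
    ultimately show ?thesis using span_two_power[OF z(1)] by metis
  qed
  thus thesis using that by blast
qed

section \<open>Valuation property, finiteness and completeness of the ring of integers\<close>

lemma integers_root:
  assumes "x ^ n \<in> L" "n > 0"
  shows "x \<in> integers \<iota>"
proof -
  have "\<forall>i. \<exists>m. 2 ^ m * x ^ i \<in> L" using arch by blast
  from choice[OF this] obtain m where m: "\<And>i. 2 ^ m i * x ^ i \<in> L" by blast
  define N where "N = Max (insert 0 (m ` {..<n}))"
  have "2 ^ N * x ^ k \<in> L" for k
  proof -
    \<comment> \<open>Splitting k by division by n leaves a power of x^n, which is in
      \<open>L\<close>, times one of finitely many remaining powers of x.\<close>
    have "m (k mod n) \<le> N" unfolding N_def using assms(2) by (intro Max_ge) auto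
    hence "2 ^ N * x ^ (k mod n) \<in> L" by (rule span_two_power_mono[OF m])
    hence "(x ^ n) ^ (k div n) * (2 ^ N * x ^ (k mod n)) \<in> L"
      by (rule L_mult[OF L_power[OF assms(1)]])
    also have "(x ^ n) ^ (k div n) * (2 ^ N * x ^ (k mod n)) = 2 ^ N * x ^ (n * (k div n) + k mod n)"
      by (simp only: power_add power_mult mult_ac)
    finally show ?thesis by simp
  qed
  thus ?thesis by (auto simp: integers_eq power_bounded_def)
qed

text \<open>Either all powers of x stay in 2^-M \<open>L\<close> and x is integral, or some power
  leaves it. Its exponent is positive because 2^M is in \<open>L\<close>, and the same power of 1 /
  x lies in 2 \<open>L\<close>, so 1 / x is integral.\<close>

lemma integers_valuation: "x \<in> integers \<iota> \<or> inverse x \<in> integers \<iota>"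
proof -
  obtain M where M: "\<And>x. 2 ^ M * x \<notin> L \<Longrightarrow> x \<noteq> 0 \<and> (\<exists>l\<in>L. inverse x = 2 * l)"
    using large_inverse by blast
  show ?thesis
  proof (cases "\<forall>n. 2 ^ M * x ^ n \<in> L")
    case True
    thus ?thesis by (auto simp: integers_eq power_bounded_def)
  next
    case False
    then obtain n where n: "2 ^ M * x ^ n \<notin> L" by blast
    have "n \<noteq> 0" using n span_two_power[OF L_one, of M] by (cases n) auto
    moreover obtain l where "l \<in> L" "inverse (x ^ n) = 2 * l" using M[OF n] by blast
    hence "inverse x ^ n \<in> L" using L_two_mult by (simp add: power_inverse)
    ultimately show ?thesis using integers_root by blast
  qed
qed

text \<open>Encloses the ring of integers between \<open>L\<close> and 2^-M \<open>L\<close>, so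
  that finiteness and completeness carry over. An x violating the bound would have 1 / x = 2 l,
  making 1/2 = x l integral.\<close>

lemma integers_bounded:
  obtains M where "\<And>x. x \<in> integers \<iota> \<Longrightarrow> 2 ^ M * x \<in> L"
proof -
  obtain M where M: "\<And>x. 2 ^ M * x \<notin> L \<Longrightarrow> x \<noteq> 0 \<and> (\<exists>l\<in>L. inverse x = 2 * l)"
    using large_inverse by blast
  have "2 ^ M * x \<in> L" if x: "x \<in> integers \<iota>" for x
  proof (rule ccontr)
    assume "2 ^ M * x \<notin> L"
    then obtain l where l: "x \<noteq> 0" "l \<in> L" "inverse x = 2 * l" using M by blast
    have "2 * (x * l) = x * inverse x" unfolding l(3) by (simp add: mult_ac)
    hence "inverse 2 = x * l" using l(1) by (intro inverse_unique) simp
    thus False using half_notin_integers integers_mult[OF x L_integers[OF l(2)]] by metis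
  qed
  thus thesis using that by blast
qed

lemma integers_finite_mod_two:
  "\<exists>F. finite F \<and> (\<forall>x\<in>integers \<iota>. \<exists>r\<in>F. \<exists>y\<in>integers \<iota>. x - r = 2 * y)"
proof -
  obtain M where M: "\<And>x. x \<in> integers \<iota> \<Longrightarrow> 2 ^ M * x \<in> L" using integers_bounded by blast
  \<comment> \<open>Classes modulo 2^(M + 1) are taken because dividing by 2^M must leave one factor
    2.\<close>
  obtain F where F: "finite F" "\<And>x. x \<in> L \<Longrightarrow> \<exists>r\<in>F. \<exists>y\<in>L. x - r = 2 ^ Suc M * y"
    using L_finite_mod_two_power[of "Suc M"] by blast
  have "\<exists>r\<in>(\<lambda>r. r / 2 ^ M) ` F. \<exists>y\<in>integers \<iota>. x - r = 2 * y" if x: "x \<in> integers \<iota>" for x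
  proof -
    obtain r y where r: "r \<in> F" "y \<in> L" "2 ^ M * x - r = 2 ^ Suc M * y"
      using F(2)[OF M[OF x]] by blast
    have "x - r / 2 ^ M = (2 ^ M * x - r) / 2 ^ M"
      using two_nonzero by (simp add: diff_divide_distrib)
    also have "\<dots> = 2 * y" unfolding r(3) using two_nonzero by simp
    finally show ?thesis using r L_integers by blast
  qed
  thus ?thesis using F(1) by blast
qed

lemma integers_sum: "(\<And>i. i < n \<Longrightarrow> f i \<in> integers \<iota>) \<Longrightarrow> (\<Sum>i<n. f i) \<in> integers \<iota>" for n :: nat
  by (induction n) (auto intro: integers_add L_integers Z.span_zero)

lemma sum_lessThan_add: "(\<Sum>i<n + m. g i) = (\<Sum>i<n. g i) + (\<Sum>i<m. g (n + i))"
  for g :: "nat \<Rightarrow> 'k"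
  by (induction m) (simp_all add: add.assoc)

lemma integers_complete:
  assumes f: "\<And>n. f n \<in> integers \<iota>"
  shows "\<exists>s\<in>integers \<iota>. \<forall>n. \<exists>t\<in>integers \<iota>. s - (\<Sum>i<n. 2 ^ i * f i) = 2 ^ n * t"
proof -
  obtain M where M: "\<And>x. x \<in> integers \<iota> \<Longrightarrow> 2 ^ M * x \<in> L" using integers_bounded by blast
  obtain s where s: "s \<in> L" "\<And>n. \<exists>t\<in>L. s - (\<Sum>i<n. 2 ^ i * (2 ^ M * f i)) = 2 ^ n * t"
    using span_complete[OF finite_G, of "\<lambda>i. 2 ^ M * f i"] M f by blast
  have *: "\<exists>t\<in>integers \<iota>. s / 2 ^ M - (\<Sum>i<n. 2 ^ i * f i) = 2 ^ n * t" for n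
  proof -
    \<comment> \<open>Division by 2^M costs M digits, so the sum is compared after n + M terms; the
      M surplus terms are divisible by 2^n.\<close>
    obtain t where t: "t \<in> L" "s - (\<Sum>i<n + M. 2 ^ i * (2 ^ M * f i)) = 2 ^ (n + M) * t"
      using s(2) by blast
    have "s = 2 ^ M * ((\<Sum>i<n + M. 2 ^ i * f i) + 2 ^ n * t)"
      using t(2) by (simp add: diff_eq_eq sum_distrib_left distrib_left power_add mult_ac add.commute)
    hence "s / 2 ^ M = (\<Sum>i<n + M. 2 ^ i * f i) + 2 ^ n * t" using two_nonzero by simp
    also have "(\<Sum>i<n + M. 2 ^ i * f i) = (\<Sum>i<n. 2 ^ i * f i) + 2 ^ n * (\<Sum>i<M. 2 ^ i * f (n + i))"
      using sum_lessThan_add[of "\<lambda>i. 2 ^ i * f i" n M]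
      by (simp add: sum_distrib_left power_add mult.assoc)
    finally have "s / 2 ^ M - (\<Sum>i<n. 2 ^ i * f i) = 2 ^ n * ((\<Sum>i<M. 2 ^ i * f (n + i)) + t)"
      by (simp add: algebra_simps)
    moreover have "(\<Sum>i<M. 2 ^ i * f (n + i)) + t \<in> integers \<iota>"
      by (intro integers_add integers_sum integers_mult L_integers span_two_power L_one t f)
        (use span_two_power[OF L_one] in simp)
    ultimately show ?thesis by blast
  qed
  have "s / 2 ^ M \<in> integers \<iota>" using *[of 0] by simp
  thus ?thesis using * by blast
qed

lemma integers_valuation_ring:
  assumes "prime_in (integers \<iota>) \<pi>"
  shows "dyadic_valuation_ring (integers \<iota>) \<pi>"
proof
  have m1: "- 1 \<in> integers \<iota>" by (intro L_integers Z.span_neg L_one)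
  show "1 \<in> integers \<iota>" by (intro L_integers L_one)
  show "x + y \<in> integers \<iota>" if "x \<in> integers \<iota>" "y \<in> integers \<iota>" for x y
    using that by (rule integers_add)
  show "- x \<in> integers \<iota>" if "x \<in> integers \<iota>" for x
    using integers_mult[OF m1 that] by simp
  show "x * y \<in> integers \<iota>" if "x \<in> integers \<iota>" "y \<in> integers \<iota>" for x y
    using that by (rule integers_mult)
  show "x \<in> integers \<iota> \<or> inverse x \<in> integers \<iota>" for x by (rule integers_valuation)
  show "inverse 2 \<notin> integers \<iota>" by (rule half_notin_integers)
  show "\<exists>n. 2 ^ n * x \<in> integers \<iota>" for x using arch L_integers by blast
  show "\<exists>F. finite F \<and> (\<forall>x\<in>integers \<iota>. \<exists>r\<in>F. \<exists>y\<in>integers \<iota>. x - r = 2 * y)"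
    by (rule integers_finite_mod_two)
  show "\<exists>s\<in>integers \<iota>. \<forall>n. \<exists>t\<in>integers \<iota>. s - (\<Sum>i<n. 2 ^ i * f i) = 2 ^ n * t"
    if "\<And>n. f n \<in> integers \<iota>" for f using that by (rule integers_complete)
qed (rule assms)

end

lemma integers_dyadic_valuation_ring:
  assumes "finite_extension \<iota>" "prime_in (integers \<iota>) \<pi>"
  shows "dyadic_valuation_ring (integers \<iota>) \<pi>"
proof -
  interpret two_adic_extension \<iota> by standard (rule assms(1))
  obtain G where G: "finite G" "1 \<in> G" "\<And>x. \<exists>m. 2 ^ m * x \<in> Z.span G"
    "\<And>x y. x \<in> Z.span G \<Longrightarrow> y \<in> Z.span G \<Longrightarrow> x * y \<in> Z.span G"
    using lattice_order_exists by blast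
  interpret two_adic_order \<iota> G by standard (rule G; assumption)+
  show ?thesis using assms(2) by (rule integers_valuation_ring)
qed

section \<open>Hilbert symbols\<close>

lemma square_class_eq_iff:
  "square_class a = square_class b \<longleftrightarrow> (\<exists>s. s \<noteq> 0 \<and> a = b * s\<^sup>2)" for a b :: "'k :: field"
proof
  assume "square_class a = square_class b"
  moreover have "a \<in> square_class a" by (auto simp: square_class_def intro!: exI[of _ 1])
  ultimately show "\<exists>s. s \<noteq> 0 \<and> a = b * s\<^sup>2" by (auto simp: square_class_def)
next
  assume "\<exists>s. s \<noteq> 0 \<and> a = b * s\<^sup>2"
  then obtain s where s: "s \<noteq> 0" "a = b * s\<^sup>2" by blast
  have "b * t\<^sup>2 = a * (t / s)\<^sup>2" "a * t\<^sup>2 = b * (s * t)\<^sup>2" for t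
    using s by (simp_all add: power_divide power_mult_distrib)
  moreover have "t / s \<noteq> 0" "s * t \<noteq> 0" if "t \<noteq> 0" for t using s that by simp_all
  ultimately show "square_class a = square_class b"
    unfolding square_class_def by blast
qed

lemma hilbert_symbol_eq_one_iff: "hilbert_symbol a b = 1 \<longleftrightarrow> (\<exists>x y. a * x\<^sup>2 + b * y\<^sup>2 = 1)"
  by (simp add: hilbert_symbol_def)

lemma hilbert_symbol_commute: "hilbert_symbol a b = hilbert_symbol b a"
  unfolding hilbert_symbol_def by (metis add.commute)

lemma hilbert_symbol_mult_square:
  assumes "s \<noteq> 0"
  shows "hilbert_symbol (a * s\<^sup>2) b = hilbert_symbol a b"
proof -
  have "a * s\<^sup>2 * x\<^sup>2 = a * (s * x)\<^sup>2" "a * x\<^sup>2 = a * s\<^sup>2 * (x / s)\<^sup>2" for x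
    using assms by (simp_all add: power_mult_distrib power_divide)
  thus ?thesis unfolding hilbert_symbol_def by metis
qed

lemma hilbert_symbol_mult_square_right:
  "s \<noteq> 0 \<Longrightarrow> hilbert_symbol a (b * s\<^sup>2) = hilbert_symbol a b"
  using hilbert_symbol_mult_square hilbert_symbol_commute by metis

lemma hilbert_symbol_one_right: "hilbert_symbol a 1 = 1"
  unfolding hilbert_symbol_eq_one_iff by (rule exI[of _ 0], rule exI[of _ 1]) simp

text \<open>A nonzero z is scaled to 1. If z = 0, the binary form itself is isotropic, hence a
  hyperbolic plane that represents 1.\<close>

lemma hilbert_symbol_isotropic:
  fixes a b :: "'k :: field"
  assumes "(2 :: 'k) \<noteq> 0" "a \<noteq> 0" "b \<noteq> 0" "x \<noteq> 0" "a * x\<^sup>2 + b * y\<^sup>2 = z\<^sup>2"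
  shows "hilbert_symbol a b = 1"
proof (cases "z = 0")
  case False
  have "a * (x / z)\<^sup>2 + b * (y / z)\<^sup>2 = (a * x\<^sup>2 + b * y\<^sup>2) / z\<^sup>2"
    by (simp add: power_divide add_divide_distrib)
  also have "\<dots> = 1" using assms(5) False by simp
  finally show ?thesis unfolding hilbert_symbol_eq_one_iff by blast
next
  case True
  hence y: "y \<noteq> 0" using assms by auto
  have b: "b * y\<^sup>2 = - (a * x\<^sup>2)" using assms(5) True by (simp add: eq_neg_iff_add_eq_0 add.commute)
  \<comment> \<open>The form becomes a (X^2 - Y^2); X and Y solve X + Y = 1 / a and X - Y =
    1.\<close>
  define X where "X = (1 + 1 / a) / 2"
  define Y where "Y = (1 / a - 1) / 2"
  have "a * X\<^sup>2 + b * (Y * y / x)\<^sup>2 = a * X\<^sup>2 + (b * y\<^sup>2) * (Y / x)\<^sup>2"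
    by (simp add: power_mult_distrib power_divide)
  also have "\<dots> = a * ((X + Y) * (X - Y))"
    unfolding b using assms(4) by (simp add: power_divide power2_eq_square algebra_simps)
  also have "X + Y = 1 / a" using assms(1)
    by (simp add: X_def Y_def add_divide_distrib[symmetric])
  also have "X - Y = 1" using assms(1)
    by (simp add: X_def Y_def diff_divide_distrib[symmetric])
  finally show ?thesis using assms(2) unfolding hilbert_symbol_eq_one_iff by auto
qed

text \<open>Passes from cosets to elements: a set stable under nonzero squares is recovered from its
  classes.\<close>

lemma hilbert_orthogonal_image:
  fixes S :: "'k :: field set"
  assumes "\<And>b s. b \<in> S \<Longrightarrow> s \<noteq> 0 \<Longrightarrow> b * s\<^sup>2 \<in> S" "0 \<notin> S"
  shows "hilbert_orthogonal (square_class ` S) =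
    square_class ` {a. a \<noteq> 0 \<and> (\<forall>b\<in>S. hilbert_symbol a b = 1)}"
proof -
  have "b \<noteq> 0 \<and> square_class b \<in> square_class ` S \<longleftrightarrow> b \<in> S" for b
  proof
    assume "b \<noteq> 0 \<and> square_class b \<in> square_class ` S"
    then obtain c where "c \<in> S" "square_class b = square_class c" by blast
    thus "b \<in> S" using assms(1) square_class_eq_iff by metis
  qed (use assms(2) in auto)
  thus ?thesis unfolding hilbert_orthogonal_def by (auto simp: image_def)
qed

context dyadic_valuation_ring
begin

text \<open>The substitution \<open>x = \<pi>\<^sup>k\<^sup>'\<close>, \<open>y = \<pi>\<^sup>k t\<close>, \<open>z = x + y + \<pi>\<^sup>e s\<close> turns \<open>a x\<^sup>2 + b y\<^sup>2 = z\<^sup>2\<close> into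
  an equation over \<open>R\<close> that is smooth in \<open>t\<close> modulo \<open>\<pi>\<close>.\<close>

lemma hilbert_symbol_orthogonal_aux:
  assumes e: "k + k' = e" and k: "k > 0" and R: "\<alpha> \<in> R" "\<beta> \<in> R"
    and a: "a = 1 + \<pi> ^ (2 * k) * \<alpha>" and b: "b = 1 + \<pi> ^ (2 * k') * \<beta>" "b \<in> U"
  shows "hilbert_symbol a b = 1"
proof -
  obtain \<epsilon> where \<epsilon>: "\<epsilon> \<in> U" "2 = \<pi> ^ e * \<epsilon>" by (rule two_eqE)
  have \<epsilon>R: "\<epsilon> \<in> R" using \<epsilon>(1) by (rule U_closed)
  have "\<pi> * (\<pi> ^ (2 * k - 1) * \<alpha>) \<sim> 0" by (intro pi_mult_cong closed R)
  also have "\<pi> * (\<pi> ^ (2 * k - 1) * \<alpha>) = \<pi> ^ (2 * k) * \<alpha>"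
    using k by (cases k) (simp_all add: mult.assoc)
  finally have "\<pi> ^ (2 * k) * \<alpha> \<sim> 0" .
  hence "a \<sim> 1" using cong_iff_diff[of a 1] by (simp add: a)
  hence a0: "a \<noteq> 0" using U_cong one_in_U U_nonzero by blast
  define P where "P = \<pi> ^ k"
  define P' where "P' = \<pi> ^ k'"
  have PR: "P \<in> R" "P' \<in> R" by (simp_all add: P_def P'_def closed)
  have P0: "P \<sim> 0" using k by (cases k) (auto simp: P_def intro!: pi_mult_cong closed)
  have two: "2 = P * P' * \<epsilon>" using \<epsilon>(2) e by (simp add: P_def P'_def power_add[symmetric])
  have a': "a = 1 + P\<^sup>2 * \<alpha>" and b': "b = 1 + P'\<^sup>2 * \<beta>"
    using a b by (simp_all add: P_def P'_def power_mult[symmetric] mult.commute)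
  \<comment> \<open>The equation left after cancelling the square of P P' has to be solved modulo
    \<pi> only. For k' > 0 the choice is t = 0 and s^2 congruent to \<alpha>.\<close>
  have "\<exists>s\<in>R. \<exists>t\<in>R. \<beta> * t\<^sup>2 + - (\<epsilon> + \<epsilon> * P * s) * t + (\<alpha> - s\<^sup>2 - \<epsilon> * P' * s) \<sim> 0"
  proof (cases "k' = 0")
    case False
    hence P'0: "P' \<sim> 0" by (cases k') (auto simp: P'_def intro!: pi_mult_cong closed)
    obtain s where s: "s \<in> R" "s\<^sup>2 \<sim> \<alpha>" using res_square_root R(1) by blast
    have "(\<alpha> - s\<^sup>2) - (\<epsilon> * s) * P' \<sim> (\<alpha> - \<alpha>) - (\<epsilon> * s) * 0"
      by (intro cong_diff cong_refl s cong_mult_left P'0 closed \<epsilon>R)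
    hence "\<alpha> - s\<^sup>2 - \<epsilon> * P' * s \<sim> 0" by (simp add: mult_ac)
    thus ?thesis using s(1) by (intro bexI[of _ s] bexI[of _ 0]) (simp_all add: closed)
  next
    case True
    \<comment> \<open>For k' = 0 the linear term in s survives modulo \<pi>. Taking t = s doubles it
      away and leaves (1 + \<beta>) s^2 congruent to \<alpha>, where 1 + \<beta> = b is a
      unit.\<close>
    hence P'1: "P' = 1" by (simp add: P'_def)
    have bU: "1 + \<beta> \<in> U" using b(2) by (simp add: b' P'1)
    obtain s where s: "s \<in> R" "s\<^sup>2 \<sim> \<alpha> / (1 + \<beta>)"
      using res_square_root U_divide_closed[OF R(1) bU] by blast
    have "\<alpha> - (1 + \<beta>) * s\<^sup>2 + (2 * (\<beta> * s\<^sup>2 - \<epsilon> * s) - (\<epsilon> * s * s) * P) \<sim>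
        \<alpha> - (1 + \<beta>) * (\<alpha> / (1 + \<beta>)) + (0 - (\<epsilon> * s * s) * 0)"
      by (intro cong_add cong_diff cong_refl cong_mult_left s two_mult_cong P0 closed R \<epsilon>R)
    also have "\<alpha> - (1 + \<beta>) * (\<alpha> / (1 + \<beta>)) + (0 - (\<epsilon> * s * s) * 0) = 0"
      using U_nonzero[OF bU] by simp
    also have "\<alpha> - (1 + \<beta>) * s\<^sup>2 + (2 * (\<beta> * s\<^sup>2 - \<epsilon> * s) - (\<epsilon> * s * s) * P) =
        \<beta> * s\<^sup>2 + - (\<epsilon> + \<epsilon> * P * s) * s + (\<alpha> - s\<^sup>2 - \<epsilon> * P' * s)"
      by (simp add: P'1 power2_eq_square algebra_simps)
    finally show ?thesis using s(1) by blast
  qed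
  then obtain s t\<^sub>0 where st: "s \<in> R" "t\<^sub>0 \<in> R"
    "\<beta> * t\<^sub>0\<^sup>2 + - (\<epsilon> + \<epsilon> * P * s) * t\<^sub>0 + (\<alpha> - s\<^sup>2 - \<epsilon> * P' * s) \<sim> 0" by blast
  \<comment> \<open>The derivative in t is congruent to -\<epsilon>, so s stays fixed and only t is
    lifted.\<close>
  have "2 * (\<beta> * t\<^sub>0) + (- \<epsilon> + (- \<epsilon> * s) * P) \<sim> 0 + (- \<epsilon> + (- \<epsilon> * s) * 0)"
    by (intro cong_add cong_refl cong_mult_left two_mult_cong P0 closed R \<epsilon>R st)
  hence "2 * \<beta> * t\<^sub>0 + - (\<epsilon> + \<epsilon> * P * s) \<sim> - \<epsilon>" by (simp add: algebra_simps)
  hence "2 * \<beta> * t\<^sub>0 + - (\<epsilon> + \<epsilon> * P * s) \<in> U" using U_cong U_uminus \<epsilon>(1) by blast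
  moreover have "- (\<epsilon> + \<epsilon> * P * s) \<in> R" "\<alpha> - s\<^sup>2 - \<epsilon> * P' * s \<in> R"
    by (intro closed R \<epsilon>R st PR)+
  ultimately obtain t where t: "\<beta> * t\<^sup>2 + - (\<epsilon> + \<epsilon> * P * s) * t + (\<alpha> - s\<^sup>2 - \<epsilon> * P' * s) = 0"
    using hensel_quadratic R(2) st(2,3) by metis
  have "a * P'\<^sup>2 + b * (P * t)\<^sup>2 - (P' + P * t + P * P' * s)\<^sup>2 =
      P\<^sup>2 * P'\<^sup>2 * (\<beta> * t\<^sup>2 + \<alpha> - s\<^sup>2) - 2 * (P * P' * (t + P' * s + P * t * s))"
    by (simp add: a' b' power2_eq_square algebra_simps)
  also have "\<dots> = P\<^sup>2 * P'\<^sup>2 * (\<beta> * t\<^sup>2 + - (\<epsilon> + \<epsilon> * P * s) * t + (\<alpha> - s\<^sup>2 - \<epsilon> * P' * s))"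
    by (subst two) (simp add: power2_eq_square algebra_simps)
  finally have "a * P'\<^sup>2 + b * (P * t)\<^sup>2 = (P' + P * t + P * P' * s)\<^sup>2" using t by simp
  moreover have "P' \<noteq> 0" using pi_nonzero by (simp add: P'_def)
  ultimately show ?thesis using hilbert_symbol_isotropic two_nonzero a0 U_nonzero[OF b(2)] by blast
qed

section \<open>Primitive vectors and anisotropic forms: symbols different from 1\<close>

lemma triple_normalize:
  assumes "r \<noteq> 0 \<or> t \<noteq> 0 \<or> s \<noteq> (0 :: 'k)"
  obtains c where "c \<noteq> 0" "r * c \<in> R" "t * c \<in> R" "s * c \<in> R" "r * c = 1 \<or> t * c = 1 \<or> s * c = 1"
proof -
  \<comment> \<open>Of two elements, not both zero, a nonzero one divides the other; two such
    comparisons find an entry dividing all three.\<close>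
  have pair: "\<exists>m\<in>{x, y}. m \<noteq> 0 \<and> x / m \<in> R \<and> y / m \<in> R" if "x \<noteq> 0 \<or> y \<noteq> 0" for x y
  proof (cases "x \<noteq> 0 \<and> y / x \<in> R")
    case True
    thus ?thesis by (auto simp: one_closed)
  next
    case False
    hence "x / y \<in> R" "y \<noteq> 0" using that valuation[of "y / x"] zero_closed by auto
    thus ?thesis by (auto simp: one_closed)
  qed
  have "\<exists>m\<in>{r, t, s}. m \<noteq> 0 \<and> r / m \<in> R \<and> t / m \<in> R \<and> s / m \<in> R"
  proof (cases "r = 0 \<and> t = 0")
    case True
    thus ?thesis using assms by (auto simp: closed)
  next
    case False
    then obtain m where m: "m \<in> {r, t}" "m \<noteq> 0" "r / m \<in> R" "t / m \<in> R" using pair[of r t] by blast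
    obtain n where n: "n \<in> {m, s}" "n \<noteq> 0" "m / n \<in> R" "s / n \<in> R" using pair[of m s] m(2) by blast
    have "(r / m) * (m / n) \<in> R" "(t / m) * (m / n) \<in> R" using m n by (intro mult_closed; simp)+
    hence "r / n \<in> R" "t / n \<in> R" using m(2) by simp_all
    thus ?thesis using m n by blast
  qed
  then obtain m where "m \<in> {r, t, s}" "m \<noteq> 0" "r / m \<in> R" "t / m \<in> R" "s / m \<in> R" by blast
  thus thesis using that[of "inverse m"] by (auto simp: divide_inverse)
qed

text \<open>The norm form \<open>X\<^sup>2 + X Y + \<rho> Y\<^sup>2\<close> of the quadratic extension of the residue field.\<close>

lemma artin_schreier_anisotropic:
  assumes \<rho>: "\<rho> \<in> R" "\<And>y. y \<in> R \<Longrightarrow> \<not> y\<^sup>2 + y \<sim> \<rho>"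
    and xy: "x \<in> R" "y \<in> R" "x\<^sup>2 + x * y - \<rho> * y\<^sup>2 \<sim> 0"
  shows "x \<sim> 0 \<and> y \<sim> 0"
proof -
  have y: "y \<sim> 0"
  proof (rule ccontr)
    assume "\<not> y \<sim> 0"
    hence yU: "y \<in> U" using cong_zero_iff xy by blast
    note y0 = U_nonzero[OF yU]
    have "inverse (y\<^sup>2) * (x\<^sup>2 + x * y - \<rho> * y\<^sup>2) \<sim> inverse (y\<^sup>2) * 0"
      by (intro cong_mult_left xy U_inverse_closed U_power yU)
    moreover have "inverse (y\<^sup>2) * (x\<^sup>2 + x * y - \<rho> * y\<^sup>2) = ((x / y)\<^sup>2 + x / y) - \<rho>"
      using y0 by (simp add: field_simps power2_eq_square)
    ultimately have "(x / y)\<^sup>2 + x / y \<sim> \<rho>" using cong_iff_diff by simp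
    thus False using \<rho>(2) U_divide_closed[OF xy(1) yU] by blast
  qed
  have "(x\<^sup>2 + x * y - \<rho> * y\<^sup>2) - (x - \<rho> * y) * y \<sim> 0 - (x - \<rho> * y) * 0"
    by (intro cong_diff xy cong_mult_left y closed \<rho>)
  hence "x\<^sup>2 \<sim> 0" by (simp add: power2_eq_square algebra_simps)
  thus ?thesis using y cong_power2_zeroD xy by blast
qed

lemma pi_cancel_cong: "\<pi> * x = \<pi>\<^sup>2 * z \<Longrightarrow> z \<in> R \<Longrightarrow> x \<sim> 0"
  using pi_nonzero by (auto simp: power2_eq_square mult.assoc intro: pi_mult_cong)

text \<open>A descent: a primitive solution would have W and X divisible by \<pi> because the norm
  form is anisotropic; then \<pi>^2 divides \<pi> u V^2, so V is divisible by \<pi> as well.\<close>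

lemma hilbert_symbol_unramified_prime:
  assumes \<rho>: "\<rho> \<in> R" "\<And>y. y \<in> R \<Longrightarrow> \<not> y\<^sup>2 + y \<sim> \<rho>" and u: "u \<in> U"
  shows "hilbert_symbol (1 + 4 * \<rho>) (\<pi> * u) \<noteq> 1"
proof
  assume "hilbert_symbol (1 + 4 * \<rho>) (\<pi> * u) = 1"
  then obtain x y where xy: "(1 + 4 * \<rho>) * x\<^sup>2 + \<pi> * u * y\<^sup>2 = 1"
    by (auto simp: hilbert_symbol_eq_one_iff)
  \<comment> \<open>With x = 1 - 2w and y = 2v the equation is divisible by 4, and the quotient is
    minus the norm form in w and x plus \<pi> u v^2.\<close>
  define w where "w = (1 - x) / 2"
  define v where "v = y / 2"
  have "2 * w = 1 - x"
    by (simp only: w_def times_divide_eq_right nonzero_mult_div_cancel_left[OF two_nonzero])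
  hence wv: "1 = x + 2 * w" "y = 2 * v" using two_nonzero by (simp_all add: v_def)
  have "4 * (\<rho> * x\<^sup>2 - x * w - w\<^sup>2 + \<pi> * u * v\<^sup>2) = (1 + 4 * \<rho>) * x\<^sup>2 + \<pi> * u * (2 * v)\<^sup>2 - (x + 2 * w)\<^sup>2"
    by (simp add: power2_eq_square algebra_simps)
  also have "\<dots> = 0" using xy wv by simp
  finally have eq: "\<rho> * x\<^sup>2 - x * w - w\<^sup>2 + \<pi> * u * v\<^sup>2 = 0"
    using two_nonzero by (metis mult_eq_0_iff mult_2 numeral_Bit0 numeral_code(1) num_double mult_numeral_1 numeral_times_numeral)
  have "x \<noteq> 0 \<or> w \<noteq> 0 \<or> v \<noteq> 0" using wv(1) by auto
  then obtain c where c: "c \<noteq> 0" "x * c \<in> R" "w * c \<in> R" "v * c \<in> R"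
    "x * c = 1 \<or> w * c = 1 \<or> v * c = 1" by (rule triple_normalize)
  define X where "X = x * c"
  define W where "W = w * c"
  define V where "V = v * c"
  have XR: "X \<in> R" "W \<in> R" "V \<in> R" using c by (simp_all add: X_def W_def V_def)
  have "W\<^sup>2 + W * X - \<rho> * X\<^sup>2 - \<pi> * (u * V\<^sup>2) = - (\<rho> * x\<^sup>2 - x * w - w\<^sup>2 + \<pi> * u * v\<^sup>2) * c\<^sup>2"
    by (simp add: X_def W_def V_def power2_eq_square algebra_simps)
  hence E: "W\<^sup>2 + W * X - \<rho> * X\<^sup>2 = \<pi> * (u * V\<^sup>2)" using eq by simp
  have uV: "u * V\<^sup>2 \<in> R" using XR U_closed[OF u] by (intro closed)
  have "W \<sim> 0 \<and> X \<sim> 0"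
    by (rule artin_schreier_anisotropic[OF \<rho> XR(2,1)]) (use E pi_mult_cong[OF uV] in simp_all)
  then obtain W' X' where W': "W' \<in> R" "X' \<in> R" "W = \<pi> * W'" "X = \<pi> * X'" by (auto simp: cong_def)
  have "\<pi> * (u * V\<^sup>2) = \<pi>\<^sup>2 * (W'\<^sup>2 + W' * X' - \<rho> * X'\<^sup>2)"
    unfolding E[symmetric] W' by (simp add: power2_eq_square algebra_simps)
  hence "u * V\<^sup>2 \<sim> 0" by (rule pi_cancel_cong) (intro closed W' \<rho>)
  hence "V \<sim> 0" using cong_mult_zeroD cong_power2_zeroD cong_zero_iff u U_closed XR closed by metis
  hence "\<not> (X = 1 \<or> W = 1 \<or> V = 1)" using \<open>W \<sim> 0 \<and> X \<sim> 0\<close> one_not_cong by auto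
  thus False using c(5) by (simp add: X_def W_def V_def)
qed

text \<open>The two odd levels add up to 2e, so the cross term coming from 2 has the same order as
  the diagonal terms. The second argument is chosen so that u times the reduced binary form is the
  norm form in u X and -\<epsilon> Y.\<close>

lemma hilbert_symbol_complementary_levels:
  assumes j: "Suc (j + j') = e" and \<rho>: "\<rho> \<in> R" "\<And>y. y \<in> R \<Longrightarrow> \<not> y\<^sup>2 + y \<sim> \<rho>"
    and u: "u \<in> U" and \<epsilon>: "\<epsilon> \<in> U" "2 = \<pi> ^ e * \<epsilon>"
  shows "hilbert_symbol (1 + \<pi> ^ (2 * j + 1) * u) (1 + \<pi> ^ (2 * j' + 1) * (- \<rho> * \<epsilon>\<^sup>2 / u)) \<noteq> 1"
proof
  define w where "w = - \<rho> * \<epsilon>\<^sup>2 / u"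
  assume "hilbert_symbol (1 + \<pi> ^ (2 * j + 1) * u) (1 + \<pi> ^ (2 * j' + 1) * (- \<rho> * \<epsilon>\<^sup>2 / u)) = 1"
  then obtain x y where xy: "(1 + \<pi> ^ (2 * j + 1) * u) * x\<^sup>2 + (1 + \<pi> ^ (2 * j' + 1) * w) * y\<^sup>2 = 1"
    by (auto simp: hilbert_symbol_eq_one_iff w_def)
  note uR = U_closed[OF u] and \<epsilon>R = U_closed[OF \<epsilon>(1)]
  have wR: "w \<in> R" unfolding w_def by (intro U_divide_closed closed \<rho> \<epsilon>R u)
  define P where "P = \<pi> ^ j"
  define P' where "P' = \<pi> ^ j'"
  have P: "P \<in> R" "P' \<in> R" "P \<noteq> 0" "P' \<noteq> 0" using pi_nonzero by (simp_all add: P_def P'_def closed)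
  have two: "2 = \<pi> * P * P' * \<epsilon>" using \<epsilon>(2) by (simp add: P_def P'_def power_add mult.assoc flip: j)
  \<comment> \<open>The substitution used for orthogonality, with z = 1: x = P' r, y = P t and 1 = x
    + y + P P' s.\<close>
  define r where "r = x / P'"
  define t where "t = y / P"
  define s where "s = ((1 - x) / P - t) / P'"
  have rts: "x = P' * r" "y = P * t" using P by (simp_all add: r_def t_def)
  have one: "1 = P' * r + P * t + P * P' * s" using P by (simp add: r_def s_def field_simps)
  have xy': "(1 + \<pi> * P\<^sup>2 * u) * x\<^sup>2 + (1 + \<pi> * P'\<^sup>2 * w) * y\<^sup>2 = 1"
    using xy by (simp add: P_def P'_def power_mult[symmetric] mult.commute)
  have "P\<^sup>2 * P'\<^sup>2 * (\<pi> * (u * r\<^sup>2 + w * t\<^sup>2 - \<epsilon> * r * t - \<epsilon> * P' * r * s - \<epsilon> * P * t * s) - s\<^sup>2) =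
      P\<^sup>2 * P'\<^sup>2 * (\<pi> * (u * r\<^sup>2 + w * t\<^sup>2) - s\<^sup>2) - (\<pi> * P * P' * \<epsilon>) * (P * P' * (r * t + P' * r * s + P * t * s))"
    by (simp add: power2_eq_square algebra_simps)
  also have "\<dots> = (1 + \<pi> * P\<^sup>2 * u) * (P' * r)\<^sup>2 + (1 + \<pi> * P'\<^sup>2 * w) * (P * t)\<^sup>2 - (P' * r + P * t + P * P' * s)\<^sup>2"
    unfolding two[symmetric] by (simp add: power2_eq_square algebra_simps)
  also have "\<dots> = 0" using xy' unfolding rts one[symmetric] by simp
  finally have eq: "\<pi> * (u * r\<^sup>2 + w * t\<^sup>2 - \<epsilon> * r * t - \<epsilon> * P' * r * s - \<epsilon> * P * t * s) - s\<^sup>2 = 0"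
    using P by simp
  have "r \<noteq> 0 \<or> t \<noteq> 0 \<or> s \<noteq> 0" using one by auto
  then obtain c where c: "c \<noteq> 0" "r * c \<in> R" "t * c \<in> R" "s * c \<in> R"
    "r * c = 1 \<or> t * c = 1 \<or> s * c = 1" by (rule triple_normalize)
  define X where "X = r * c"
  define Y where "Y = t * c"
  define Z where "Z = s * c"
  have XR: "X \<in> R" "Y \<in> R" "Z \<in> R" using c by (simp_all add: X_def Y_def Z_def)
  have "\<pi> * (u * X\<^sup>2 + w * Y\<^sup>2 - \<epsilon> * X * Y - \<epsilon> * P' * X * Z - \<epsilon> * P * Y * Z) - Z\<^sup>2 =
      (\<pi> * (u * r\<^sup>2 + w * t\<^sup>2 - \<epsilon> * r * t - \<epsilon> * P' * r * s - \<epsilon> * P * t * s) - s\<^sup>2) * c\<^sup>2"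
    by (simp add: X_def Y_def Z_def power2_eq_square algebra_simps)
  hence E: "Z\<^sup>2 = \<pi> * (u * X\<^sup>2 + w * Y\<^sup>2 - \<epsilon> * X * Y - \<epsilon> * P' * X * Z - \<epsilon> * P * Y * Z)"
    using eq by simp
  \<comment> \<open>First Z is divisible by \<pi>. After cancelling one \<pi>, every term containing
    Z vanishes modulo \<pi> and a binary form in X and Y remains.\<close>
  have "Z\<^sup>2 \<sim> 0" unfolding E by (intro pi_mult_cong closed XR P uR wR \<epsilon>R)
  hence Z: "Z \<sim> 0" using cong_power2_zeroD XR by blast
  then obtain Z' where Z': "Z' \<in> R" "Z = \<pi> * Z'" by (auto simp: cong_def)
  have "\<pi> * (u * X\<^sup>2 + w * Y\<^sup>2 - \<epsilon> * X * Y) = \<pi>\<^sup>2 * (Z'\<^sup>2 + \<epsilon> * P' * X * Z' + \<epsilon> * P * Y * Z')"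
    using E unfolding Z'(2) by (simp add: power2_eq_square algebra_simps)
  hence "u * X\<^sup>2 + w * Y\<^sup>2 - \<epsilon> * X * Y \<sim> 0"
    by (rule pi_cancel_cong) (intro closed XR P \<epsilon>R Z')
  hence "u * (u * X\<^sup>2 + w * Y\<^sup>2 - \<epsilon> * X * Y) \<sim> u * 0" by (intro cong_mult_left uR)
  moreover have "u * w = - \<rho> * \<epsilon>\<^sup>2" using U_nonzero[OF u] by (simp add: w_def)
  hence "u * (u * X\<^sup>2 + w * Y\<^sup>2 - \<epsilon> * X * Y) = (u * X)\<^sup>2 + (u * X) * (- \<epsilon> * Y) - \<rho> * (- \<epsilon> * Y)\<^sup>2"
    by (simp add: distrib_left right_diff_distrib mult.assoc[symmetric]) (simp add: power2_eq_square algebra_simps)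
  ultimately have "(u * X)\<^sup>2 + (u * X) * (- \<epsilon> * Y) - \<rho> * (- \<epsilon> * Y)\<^sup>2 \<sim> 0" by simp
  hence "u * X \<sim> 0 \<and> - \<epsilon> * Y \<sim> 0"
    by (intro artin_schreier_anisotropic[OF \<rho>] closed uR \<epsilon>R XR)
  hence "X \<sim> 0" "Y \<sim> 0"
    using cong_mult_zeroD[of u X] cong_mult_zeroD[of "- \<epsilon>" Y] cong_zero_iff[of u] cong_zero_iff[of "- \<epsilon>"]
      u \<epsilon>(1) uR \<epsilon>R XR U_uminus uminus_closed by blast+
  hence "\<not> (X = 1 \<or> Y = 1 \<or> Z = 1)" using Z one_not_cong by auto
  thus False using c(5) by (simp add: X_def Y_def Z_def)
qed

section \<open>The unit filtration modulo squares\<close>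

definition unit_group :: "nat \<Rightarrow> 'k set" where
  "unit_group n = (if n = 0 then U else {1 + \<pi> ^ n * x | x. x \<in> R})"

lemma unit_group_subset_U: "unit_group n \<subseteq> U"
proof (cases n)
  case (Suc m)
  have "1 + \<pi> ^ n * x \<in> U" if "x \<in> R" for x
  proof (rule U_cong[OF _ one_in_U])
    show "1 + \<pi> ^ n * x \<sim> 1"
      unfolding cong_iff_diff[of _ 1] using that by (auto simp: Suc mult.assoc intro!: pi_mult_cong closed)
  qed
  thus ?thesis by (auto simp: unit_group_def Suc)
qed (simp add: unit_group_def)

lemma unit_group_antimono:
  assumes "m \<le> n"
  shows "unit_group n \<subseteq> unit_group m"
proof (cases "m = 0")
  case True
  thus ?thesis using unit_group_subset_U by (simp add: unit_group_def)
next
  case False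
  have "1 + \<pi> ^ n * x \<in> unit_group m" if "x \<in> R" for x
  proof -
    have "\<pi> ^ n * x = \<pi> ^ m * (\<pi> ^ (n - m) * x)" using assms by (simp add: mult.assoc[symmetric] flip: power_add)
    thus ?thesis using False that by (auto simp: unit_group_def intro!: closed)
  qed
  thus ?thesis using False assms by (auto simp: unit_group_def)
qed

text \<open>At level 0 the representation holds with \<alpha> = x - 1, so level 0 is treated
  together with the positive ones.\<close>

lemma unit_group_form:
  assumes "x \<in> unit_group n"
  obtains \<alpha> where "\<alpha> \<in> R" "x = 1 + \<pi> ^ n * \<alpha>"
proof (cases "n = 0")
  case True
  thus thesis using that[of "x - 1"] assms by (auto simp: unit_group_def U_closed closed)
qed (use assms that in \<open>auto simp: unit_group_def\<close>)

lemma hilbert_symbol_orthogonal: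
  assumes "k \<le> e" "a \<in> unit_group (2 * k)" "b \<in> unit_group (2 * (e - k))"
  shows "hilbert_symbol a b = 1"
proof -
  obtain \<alpha> where a: "\<alpha> \<in> R" "a = 1 + \<pi> ^ (2 * k) * \<alpha>" using unit_group_form assms(2) by blast
  obtain \<beta> where b: "\<beta> \<in> R" "b = 1 + \<pi> ^ (2 * (e - k)) * \<beta>" using unit_group_form assms(3) by blast
  have U: "a \<in> U" "b \<in> U" using assms unit_group_subset_U by blast+
  show ?thesis
  proof (cases "k = 0")
    case True
    \<comment> \<open>The auxiliary lemma wants a positive first level. For k = 0 the other level is
      e > 0, so the arguments are exchanged.\<close>
    have "hilbert_symbol b a = 1"
      by (rule hilbert_symbol_orthogonal_aux[of "e - k" k \<beta> \<alpha>]) (use assms a b U True e_pos in auto)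
    thus ?thesis by (simp add: hilbert_symbol_commute)
  next
    case False
    thus ?thesis
      by (intro hilbert_symbol_orthogonal_aux[of k "e - k" \<alpha> \<beta>]) (use assms a b U in auto)
  qed
qed

text \<open>For n > 0 the square of 1 + \<pi>^n d with d^2 congruent to \<alpha> matches a to the
  next level: its cross term 2 \<pi>^n d has order at least e + n, which is at least 2n + 1 because
  n < e. For n = 0 a residual square root does the same.\<close>

lemma square_mod_pi_power:
  assumes n: "n < e" and a: "a \<in> unit_group (2 * n)"
  obtains c x where "c \<in> U" "x \<in> R" "a = (1 + \<pi> ^ (2 * n + 1) * x) * c\<^sup>2"
proof -
  obtain \<alpha> where \<alpha>: "\<alpha> \<in> R" "a = 1 + \<pi> ^ (2 * n) * \<alpha>" using unit_group_form a by blast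
  have aU: "a \<in> U" using a unit_group_subset_U by blast
  have "\<exists>c\<in>U. \<exists>y\<in>R. a - c\<^sup>2 = \<pi> ^ (2 * n + 1) * y"
  proof (cases "n = 0")
    case True
    obtain c where c: "c \<in> R" "c\<^sup>2 \<sim> a" using res_square_root U_closed[OF aU] by blast
    have "c * c \<in> U" using U_cong[OF c(2) aU] by (simp add: power2_eq_square)
    hence "c \<in> U" using U_mult_left_dest c(1) by blast
    thus ?thesis using cong_sym[OF c(2)] True by (auto simp: cong_def)
  next
    case False
    obtain d where d: "d \<in> R" "d\<^sup>2 \<sim> \<alpha>" using res_square_root \<alpha>(1) by blast
    obtain z where z: "z \<in> R" "\<alpha> - d\<^sup>2 = \<pi> * z" using cong_sym[OF d(2)] by (auto simp: cong_def)
    obtain \<epsilon> where \<epsilon>: "\<epsilon> \<in> U" "2 = \<pi> ^ e * \<epsilon>" by (rule two_eqE)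
    define c where "c = 1 + \<pi> ^ n * d"
    have "c \<in> unit_group n" using False d by (auto simp: c_def unit_group_def)
    hence cU: "c \<in> U" using unit_group_subset_U by blast
    have "a - c\<^sup>2 = \<pi> ^ (2 * n) * (\<alpha> - d\<^sup>2) - 2 * (\<pi> ^ n * d)"
      unfolding \<alpha>(2) c_def power_even_eq by (simp add: power2_eq_square algebra_simps)
    also have "\<dots> = \<pi> ^ (2 * n + 1) * z - \<pi> ^ (e + n) * (\<epsilon> * d)"
      unfolding z(2) by (subst \<epsilon>(2)) (simp add: power_add algebra_simps)
    also have "e + n = (2 * n + 1) + (e - n - 1)" using n by simp
    also have "\<pi> ^ (2 * n + 1) * z - \<pi> ^ ((2 * n + 1) + (e - n - 1)) * (\<epsilon> * d) =
        \<pi> ^ (2 * n + 1) * (z - \<pi> ^ (e - n - 1) * (\<epsilon> * d))"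
      unfolding power_add[of \<pi> "2 * n + 1"] right_diff_distrib mult.assoc ..
    finally have "a - c\<^sup>2 = \<pi> ^ (2 * n + 1) * (z - \<pi> ^ (e - n - 1) * (\<epsilon> * d))" .
    moreover have "z - \<pi> ^ (e - n - 1) * (\<epsilon> * d) \<in> R" by (intro closed z d U_closed[OF \<epsilon>(1)])
    ultimately show ?thesis using cU by blast
  qed
  then obtain c y where c: "c \<in> U" "y \<in> R" "a - c\<^sup>2 = \<pi> ^ (2 * n + 1) * y" by blast
  have "a = c\<^sup>2 + \<pi> ^ (2 * n + 1) * y" using c(3) by (simp add: algebra_simps)
  hence "a = (1 + \<pi> ^ (2 * n + 1) * (y / c\<^sup>2)) * c\<^sup>2"
    using U_nonzero[OF c(1)] by (simp add: field_simps)
  thus thesis using that c U_divide_closed U_power by blast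
qed

text \<open>Climbing the even levels modulo squares: in 1 + \<pi>^(2n + 1) x, a unit x ends the
  climb at an odd level, and a nonunit x leads to level 2n + 2.\<close>

lemma unit_square_classes:
  assumes "n \<le> e" "a \<in> U"
  shows "(\<exists>v s. v \<in> unit_group (2 * n) \<and> s \<noteq> 0 \<and> a = v * s\<^sup>2) \<or>
    (\<exists>i<n. \<exists>u\<in>U. \<exists>s. s \<noteq> 0 \<and> a = (1 + \<pi> ^ (2 * i + 1) * u) * s\<^sup>2)"
  using assms(1)
proof (induction n)
  case 0
  have "a \<in> unit_group 0" using assms by (simp add: unit_group_def)
  thus ?case by (intro disjI1 exI[of _ a] exI[of _ 1]) simp
next
  case (Suc n)
  from Suc.IH Suc.prems consider v s where "v \<in> unit_group (2 * n)" "s \<noteq> 0" "a = v * s\<^sup>2"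
    | i u s where "i < n" "u \<in> U" "s \<noteq> 0" "a = (1 + \<pi> ^ (2 * i + 1) * u) * s\<^sup>2" by fastforce
  thus ?case
  proof cases
    case 1
    have n: "n < e" using Suc.prems by simp
    obtain c x where c: "c \<in> U" "x \<in> R" "v = (1 + \<pi> ^ (2 * n + 1) * x) * c\<^sup>2"
      using square_mod_pi_power[OF n 1(1)] by blast
    have cs: "c * s \<noteq> 0" "a = (1 + \<pi> ^ (2 * n + 1) * x) * (c * s)\<^sup>2"
      using c 1 U_nonzero by (auto simp: power_mult_distrib mult.assoc)
    show ?thesis
    proof (cases "x \<in> U")
      case True
      thus ?thesis using cs by blast
    next
      case False
      then obtain y where y: "y \<in> R" "x = \<pi> * y" using nonunitE c(2) by blast
      have "1 + \<pi> ^ (2 * n + 1) * x \<in> unit_group (2 * Suc n)"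
        using y by (auto simp: unit_group_def mult_ac)
      thus ?thesis using cs by blast
    qed
  next
    case 2
    thus ?thesis using less_SucI by blast
  qed
qed

lemma square_classes_cases:
  assumes "a \<noteq> 0"
  obtains u s where "u \<in> U" "s \<noteq> 0" "a = u * s\<^sup>2" | u s where "u \<in> U" "s \<noteq> 0" "a = \<pi> * u * s\<^sup>2"
proof -
  obtain u m n where u: "u \<in> U" "\<pi> ^ m * a = \<pi> ^ n * u" using unit_decomposition[OF assms] by blast
  \<comment> \<open>The valuation n - m has the parity of m + n, and a = \<pi>^(n + m) u /
    \<pi>^(2m); s collects the even part without integer exponents.\<close>
  define s where "s = \<pi> ^ ((m + n) div 2) / \<pi> ^ m"
  have s: "s \<noteq> 0" using pi_nonzero by (simp add: s_def)
  have "a = \<pi> ^ (n + m) * u / (\<pi> ^ m)\<^sup>2"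
    using u(2) pi_nonzero by (simp add: power_add power2_eq_square field_simps)
  also have "n + m = (m + n) mod 2 + 2 * ((m + n) div 2)" by simp
  also have "\<pi> ^ \<dots> * u / (\<pi> ^ m)\<^sup>2 = \<pi> ^ ((m + n) mod 2) * u * s\<^sup>2"
    unfolding power_add s_def by (simp add: power_divide power_even_eq)
  finally have a: "a = \<pi> ^ ((m + n) mod 2) * u * s\<^sup>2" .
  show thesis
  proof (cases "even (m + n)")
    case True
    thus thesis using that(1)[OF u(1) s] a by simp
  next
    case False
    hence "(m + n) mod 2 = 1" by presburger
    thus thesis using that(2)[OF u(1) s] a by simp
  qed
qed

lemma four_eq:
  assumes "2 = \<pi> ^ e * \<epsilon>"
  shows "4 = \<pi> ^ (2 * e) * \<epsilon>\<^sup>2"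
proof -
  have "(4 :: 'k) = 2\<^sup>2" by simp
  also have "\<dots> = (\<pi> ^ e * \<epsilon>)\<^sup>2" by (rule arg_cong[OF assms])
  also have "\<dots> = \<pi> ^ (2 * e) * \<epsilon>\<^sup>2" by (simp add: power_mult_distrib power_even_eq)
  finally show ?thesis .
qed

text \<open>Write a = 1 + 4 \<rho>. Since (1 + 2y)^2 = 1 + 4 (y^2 + y), a residual solution of y^2 +
  y = \<rho> lifts, its derivative 2y + 1 being a unit, and makes a a square. Without one,
  \<open>hilbert_symbol_unramified_prime\<close> applies.\<close>

lemma square_or_unramified:
  assumes "a \<in> unit_group (2 * e)"
  shows "(\<exists>s. s \<noteq> 0 \<and> a = s\<^sup>2) \<or> hilbert_symbol a \<pi> \<noteq> 1"
proof -
  obtain \<epsilon> where \<epsilon>: "\<epsilon> \<in> U" "2 = \<pi> ^ e * \<epsilon>" by (rule two_eqE)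
  obtain \<alpha> where \<alpha>: "\<alpha> \<in> R" "a = 1 + \<pi> ^ (2 * e) * \<alpha>" using unit_group_form assms by blast
  define \<rho> where "\<rho> = \<alpha> / \<epsilon>\<^sup>2"
  have \<rho>R: "\<rho> \<in> R" unfolding \<rho>_def by (intro U_divide_closed U_power \<alpha> \<epsilon>)
  have a: "a = 1 + 4 * \<rho>"
    using \<alpha>(2) U_nonzero[OF \<epsilon>(1)] by (simp add: \<rho>_def four_eq[OF \<epsilon>(2)])
  show ?thesis
  proof (cases "\<exists>y\<in>R. y\<^sup>2 + y \<sim> \<rho>")
    case True
    then obtain y\<^sub>0 where y0: "y\<^sub>0 \<in> R" "y\<^sub>0\<^sup>2 + y\<^sub>0 \<sim> \<rho>" by blast
    have "2 * y\<^sub>0 + 1 \<sim> 0 + 1" by (intro cong_add two_mult_cong y0 cong_refl)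
    hence "2 * 1 * y\<^sub>0 + 1 \<in> U" using U_cong[OF _ one_in_U] by simp
    moreover have "1 * y\<^sub>0\<^sup>2 + 1 * y\<^sub>0 + - \<rho> \<sim> 0" using y0(2) cong_iff_diff by simp
    ultimately obtain y where y: "1 * y\<^sup>2 + 1 * y + - \<rho> = 0"
      using hensel_quadratic[of 1 1 "- \<rho>" y\<^sub>0] y0(1) \<rho>R closed by metis
    have "a = (1 + 2 * y)\<^sup>2 - 4 * (1 * y\<^sup>2 + 1 * y + - \<rho>)"
      by (simp add: a power2_eq_square algebra_simps)
    hence "a = (1 + 2 * y)\<^sup>2" unfolding y by simp
    moreover have "a \<noteq> 0" using assms unit_group_subset_U U_nonzero by blast
    ultimately show ?thesis by auto
  next
    case False
    hence "hilbert_symbol (1 + 4 * \<rho>) (\<pi> * 1) \<noteq> 1"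
      by (intro hilbert_symbol_unramified_prime \<rho>R one_in_U) blast
    thus ?thesis by (simp add: a)
  qed
qed

section \<open>The subspaces as unions of square classes, and their orthogonality\<close>

definition V_rep :: "int \<Rightarrow> 'k set" where
  "V_rep k = (if k < 0 then {a. a \<noteq> 0}
     else if k \<le> int e then {u * s\<^sup>2 | u s. u \<in> unit_group (nat (2 * k)) \<and> s \<noteq> 0}
     else {s\<^sup>2 | s. s \<noteq> 0})"

lemma V_rep_nat: "k \<le> e \<Longrightarrow> V_rep (int k) = {u * s\<^sup>2 | u s. u \<in> unit_group (2 * k) \<and> s \<noteq> 0}"
  by (simp add: V_rep_def nat_mult_distrib)

lemma V_rep_nonzero: "0 \<notin> V_rep k"
proof -
  have "u * s\<^sup>2 \<noteq> 0" if "u \<in> unit_group n" "s \<noteq> 0" for u s n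
    using that unit_group_subset_U U_nonzero by auto
  thus ?thesis by (auto simp: V_rep_def)
qed

lemma V_rep_mult_square:
  assumes "b \<in> V_rep k" "s \<noteq> 0"
  shows "b * s\<^sup>2 \<in> V_rep k"
proof -
  have *: "u * t\<^sup>2 * s\<^sup>2 = u * (t * s)\<^sup>2" "t\<^sup>2 * s\<^sup>2 = (t * s)\<^sup>2" for u t
    by (simp_all add: power_mult_distrib)
  have "t * s \<noteq> 0" if "t \<noteq> 0" for t using that assms by simp
  thus ?thesis using assms(1) unfolding V_rep_def by (auto simp: * split: if_splits; blast)
qed

lemma symbol_detects_level:
  assumes k: "k \<le> e" and a: "a \<noteq> 0" "\<And>b. b \<in> unit_group (2 * k) \<Longrightarrow> hilbert_symbol a b = 1"
  shows "a \<in> V_rep (int (e - k))"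
proof -
  obtain \<rho> where \<rho>: "\<rho> \<in> R" "\<And>y. y \<in> R \<Longrightarrow> \<not> y\<^sup>2 + y \<sim> \<rho>"
    using artin_schreier_nonsurjective by blast
  obtain \<epsilon> where \<epsilon>: "\<epsilon> \<in> U" "2 = \<pi> ^ e * \<epsilon>" by (rule two_eqE)
  show ?thesis
    using a(1)
  proof (cases rule: square_classes_cases)
    case (2 u s)
    \<comment> \<open>An element of odd valuation is excluded by 1 + 4 \<rho>, which lies in level
      2e and hence in level 2k.\<close>
    have eq: "1 + 4 * \<rho> = 1 + \<pi> ^ (2 * e) * (\<epsilon>\<^sup>2 * \<rho>)"
      by (simp add: four_eq[OF \<epsilon>(2)] mult.assoc)
    have "\<epsilon>\<^sup>2 * \<rho> \<in> R" by (intro closed \<rho> U_closed[OF \<epsilon>(1)])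
    hence "1 + 4 * \<rho> \<in> unit_group (2 * e)"
      unfolding eq using e_pos by (auto simp: unit_group_def)
    hence "hilbert_symbol a (1 + 4 * \<rho>) = 1"
      using a(2) unit_group_antimono[of "2 * k" "2 * e"] k by auto
    hence "hilbert_symbol (\<pi> * u) (1 + 4 * \<rho>) = 1"
      using 2 by (simp add: hilbert_symbol_mult_square)
    hence "hilbert_symbol (1 + 4 * \<rho>) (\<pi> * u) = 1" by (simp only: hilbert_symbol_commute)
    thus ?thesis using hilbert_symbol_unramified_prime[OF \<rho> 2(1)] by simp
  next
    case (1 u s)
    have "\<not> (\<exists>i<e - k. \<exists>v\<in>U. \<exists>t. t \<noteq> 0 \<and> u = (1 + \<pi> ^ (2 * i + 1) * v) * t\<^sup>2)"
    proof clarify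
      fix i v t assume i: "i < e - k" and v: "v \<in> U" "t \<noteq> 0" "u = (1 + \<pi> ^ (2 * i + 1) * v) * t\<^sup>2"
      \<comment> \<open>The index complementary to i; i < e - k puts the witness b into level
        2k.\<close>
      define i' where "i' = e - i - 1"
      have i': "Suc (i + i') = e" "2 * k \<le> 2 * i' + 1" using i by (simp_all add: i'_def)
      define w where "w = - \<rho> * \<epsilon>\<^sup>2 / v"
      define b where "b = 1 + \<pi> ^ (2 * i' + 1) * w"
      have "w \<in> R" unfolding w_def by (intro U_divide_closed closed \<rho> U_closed[OF \<epsilon>(1)] v)
      hence "b \<in> unit_group (2 * i' + 1)" unfolding b_def unit_group_def by auto
      hence "hilbert_symbol a b = 1" using a(2) unit_group_antimono[OF i'(2)] by blast
      moreover have "a = (1 + \<pi> ^ (2 * i + 1) * v) * (t * s)\<^sup>2"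
        using v 1 by (simp add: power_mult_distrib mult.assoc)
      ultimately have "hilbert_symbol (1 + \<pi> ^ (2 * i + 1) * v) b = 1"
        using hilbert_symbol_mult_square[of "t * s"] v 1 by simp
      thus False
        using hilbert_symbol_complementary_levels[OF i'(1) \<rho> v(1) \<epsilon>] unfolding b_def w_def by blast
    qed
    then obtain v t where v: "v \<in> unit_group (2 * (e - k))" "t \<noteq> 0" "u = v * t\<^sup>2"
      using unit_square_classes[OF diff_le_self 1(1)] by blast
    have "a = v * (t * s)\<^sup>2" "t * s \<noteq> 0" using v 1 by (simp_all add: power_mult_distrib mult.assoc)
    thus ?thesis using v(1) unfolding V_rep_nat[OF diff_le_self] by blast
  qed
qed

lemma V_rep_orthogonal:
  assumes "- 1 \<le> k" "k \<le> int e + 1"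
  shows "{a. a \<noteq> 0 \<and> (\<forall>b\<in>V_rep k. hilbert_symbol a b = 1)} = V_rep (int e - k)"
proof -
  consider "k = - 1" | "k = int e + 1" | m where "m \<le> e" "k = int m"
    using assms by (cases "k < 0 \<or> k > int e") (force, metis nat_0_le nat_le_iff not_le)
  thus ?thesis
  proof cases
    case 1
    have "a \<in> V_rep (int e + 1)" if a: "a \<noteq> 0" "\<And>b. b \<noteq> 0 \<Longrightarrow> hilbert_symbol a b = 1" for a
    proof -
      \<comment> \<open>Pairing with all units confines a to level e; pairing with \<pi> then leaves
        only squares.\<close>
      have "a \<in> V_rep (int (e - 0))"
        using a unit_group_subset_U U_nonzero by (intro symbol_detects_level) blast+
      then obtain v s where v: "v \<in> unit_group (2 * e)" "s \<noteq> 0" "a = v * s\<^sup>2"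
        unfolding V_rep_nat[OF diff_le_self] by auto
      have "hilbert_symbol v \<pi> = 1"
        using a(2)[OF pi_nonzero] v by (simp add: hilbert_symbol_mult_square)
      then obtain t where "t \<noteq> 0" "v = t\<^sup>2" using square_or_unramified[OF v(1)] by blast
      hence "a = (t * s)\<^sup>2" "t * s \<noteq> 0" using v by (simp_all add: power_mult_distrib)
      thus ?thesis unfolding V_rep_def by auto
    qed
    moreover have "hilbert_symbol (s\<^sup>2) b = 1" if "s \<noteq> 0" for s b
      using hilbert_symbol_mult_square[OF that, of 1 b] hilbert_symbol_one_right[of b]
      by (simp add: hilbert_symbol_commute)
    ultimately show ?thesis using 1 by (auto simp: V_rep_def)
  next
    case 2
    have "hilbert_symbol a (s\<^sup>2) = 1" if "s \<noteq> 0" for s a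
      using hilbert_symbol_mult_square_right[OF that, of a 1] hilbert_symbol_one_right[of a] by simp
    thus ?thesis using 2 by (auto simp: V_rep_def)
  next
    case 3
    have em: "int e - k = int (e - m)" using 3 by simp
    have 1: "a \<in> V_rep (int (e - m))" if "a \<noteq> 0" "\<forall>b\<in>V_rep k. hilbert_symbol a b = 1" for a
    proof (rule symbol_detects_level[OF 3(1) that(1)])
      fix b assume "b \<in> unit_group (2 * m)"
      hence "b * 1\<^sup>2 \<in> V_rep k" unfolding 3(2) V_rep_nat[OF 3(1)] by (metis (mono_tags, lifting) mem_Collect_eq zero_neq_one)
      thus "hilbert_symbol a b = 1" using that by simp
    qed
    have 2: "hilbert_symbol a b = 1" if ab: "a \<in> V_rep (int (e - m))" "b \<in> V_rep k" for a b
    proof -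
      obtain u s where u: "u \<in> unit_group (2 * (e - m))" "s \<noteq> 0" "a = u * s\<^sup>2"
        using ab(1) unfolding V_rep_nat[OF diff_le_self] by blast
      obtain v t where v: "v \<in> unit_group (2 * m)" "t \<noteq> 0" "b = v * t\<^sup>2"
        using ab(2) unfolding 3(2) V_rep_nat[OF 3(1)] by blast
      have "hilbert_symbol v u = 1" using hilbert_symbol_orthogonal[OF 3(1) v(1) u(1)] .
      thus ?thesis using u v
        by (simp add: hilbert_symbol_mult_square hilbert_symbol_mult_square_right hilbert_symbol_commute)
    qed
    show ?thesis unfolding em using 1 2 V_rep_nonzero by blast
  qed
qed

end

theorem theorem24:
  fixes \<iota> :: "two_adic \<Rightarrow> 'k :: field" and \<pi> :: 'k and k :: int
  assumes "finite_extension \<iota>"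
    and "prime_in (integers \<iota>) \<pi>"
    and "- 1 \<le> k" and "k \<le> int (ramification_index \<iota> \<pi>) + 1"
  shows "hilbert_orthogonal (V_filtration \<iota> \<pi> k) =
    V_filtration \<iota> \<pi> (int (ramification_index \<iota> \<pi>) - k)"
proof -
  interpret dyadic_valuation_ring "integers \<iota>" \<pi>
    by (rule integers_dyadic_valuation_ring) (rule assms)+
  have e: "ramification_index \<iota> \<pi> = e" by (simp add: ramification_index_def e_def)
  have unit: "unit_filtration \<iota> \<pi> n = unit_group n" for n
    by (simp add: unit_filtration_def unit_group_def U_def)
  have trivial: "square_class ` {s\<^sup>2 | s. s \<noteq> 0} = {square_class (1 :: 'k)}"
  proof -
    have "square_class (s\<^sup>2) = square_class 1" if "s \<noteq> 0" for s :: 'k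
      using that by (auto simp: square_class_eq_iff)
    moreover have "1 \<in> {s\<^sup>2 | s :: 'k. s \<noteq> 0}" by (auto intro!: exI[of _ 1])
    ultimately show ?thesis by blast
  qed
  \<comment> \<open>Holds for every integer i, as both sides follow the same case distinction; above
    e the nonzero squares form the single class of 1.\<close>
  have V: "V_filtration \<iota> \<pi> i = square_class ` V_rep i" for i
    by (simp add: V_filtration_def V_rep_def e unit square_classes_def trivial)
  have "hilbert_orthogonal (square_class ` V_rep k) =
      square_class ` {a. a \<noteq> 0 \<and> (\<forall>b\<in>V_rep k. hilbert_symbol a b = 1)}"
    using V_rep_mult_square V_rep_nonzero by (rule hilbert_orthogonal_image)
  thus ?thesis
    unfolding e V using assms(3,4) by (simp add: e V_rep_orthogonal)
qed

end
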